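(* Let $n\geq 2$, let $\vec{k}=(k_1,\ldots,k_m)$ with $1\leq k_i\leq n-1$, let $G\in F_n(\vec{k})$ be an $\mathfrak{sl}_n$ web, and let $S^{\star}$ be a leading term stranding of $G$. Then the tableau $T_{S^{\star}}$ of $S^\star$ is a row-strict tableau of type $\vec k$, i.e. $T_{S^{\star}}\in\mathcal{RST}_n(\vec{k})$.
   Context: **Webs.** Fix a horizontal line in $\mathbb{R}^2$ (the boundary axis). A half-plane graph is a finite graph embedded in the closed half-plane below the boundary axis, up to planar isotopy fixing the axis, meeting the axis in a finite set of vertices (boundary vertices; all other vertices are interior). For an oriented edge $e$ incident to a vertex $v$, put $\sigma_v(e)=1$ if $e$ is directed into $v$ and $-1$ if directed out of $v$. An $\mathfrak{sl}_n$ web is a directed half-plane graph $G$ with edge weights in $\{1,\ldots,n-1\}$, univalent boundary vertices, trivalent interior vertices, and $\sum_{i=1}^3\sigma_v(e_i)\ell_i\equiv 0 \pmod n$ at each interior vertex $v$ with incident edges $e_1,e_2,e_3$ of weights $\ell_1,\ell_2,\ell_3$. If $v_1,\ldots,v_m$ are the boundary vertices from left to right with boundary edges $e_i$ of weights $\ell_i$, the boundary weight vector is $\vec k=(k_1,\ldots,k_m)$ with $k_i=\ell_i$ if $\sigma_{v_i}(e_i)=1$ and $k_i=n-\ell_i$ if $\sigma_{v_i}(e_i)=-1$. $F_n(\vec k)$ is the set of $\mathfrak{sl}_n$ webs with boundary weight vector $\vec k$. **Curves.** An arc on $G$ is an oriented simple path in $G$ with both endpoints on the boundary axis; it is clockwise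 (resp. counterclockwise) if its terminal vertex is to the left (resp. right) of its initial vertex. A loop is an oriented simple closed path in $G$, clockwise or counterclockwise according to its orientation. A curve system on $G$ is a collection of arcs (open curves) and loops (closed curves). Orientations of curves need not agree with those of edges. **Strandings.** A stranding $S$ of $G$ is a curve system on $G$ whose curves (simple strands) are colored by $\{1,\ldots,n-1\}$ so that simple strands of the same color are pairwise disjoint. For an edge $e$, $S(e)=S^+(e)\sqcup S^-(e)$, where $S^+(e)$ (resp. $S^-(e)$) is the set of colors of simple strands directed with (resp. against) $e$; $\alpha_c^\vee(S(e))=1,-1,0$ according as $c\in S^+(e)$, $c\in S^-(e)$, $c\notin S(e)$. $S$ is valid if for each edge $e$ of weight $\ell$: (1) the nonzero $\alpha_c^\vee(S(e))$ alternate in sign as $c$ increases; (2) with $c_{\max}=\max S(e)$, $\sum_{c}\alpha_c^\vee(S(e))\,c$ equals $\ell$ if $c_{\max}\in S^+(e)$ and $\ell-n$ if $c_{\max}\in S^-(e)$. $\mathcal{S}tr(G)$ is the set of valid strandings. For $S\in\mathcal{S}tr(G)$, $b_S(e)=b_1\cdots b_n\in\{0,1\}^n$ is the binary vector with $b_c-b_{c+1}=\alpha_c^\vee(S(e))$ for $1\le c\le n-1$ and $b_n=0$ if $c_{\max}\in S^+(e)$, $b_n=1$ if $c_{\max}\in S^-(e)$; it has exactly $\ell$ ones. **$(i,j)$-strands.** For $1\le i<j\le n$, $L_{(i,j)}(S)$ is the curve system traversing each edge $e=u\mapsto v$ with $b_S(e)=b_1\cdots b_n$ from $u$ to $v$ if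 $b_i-b_j=1$, from $v$ to $u$ if $b_i-b_j=-1$, and not at all if $b_i=b_j$. These assemble into disjoint arcs and loops; each component is an $(i,j)$-strand of $S$. **Web vector.** $V_k=\bigwedge_q^k\mathbb{C}_q^n$ is the $\mathbb{C}(q)$-vector space with basis the monomials $x_{\vec b}=x_{j_1}\wedge_q\cdots\wedge_q x_{j_k}$, $\vec b\in\{0,1\}^n$ with $|\vec b|=k$ ones, where $j_1<\cdots<j_k$ are the positions of the ones; $V_n(\vec k)=V_{k_1}\otimes\cdots\otimes V_{k_m}$ has basis of monomials $x_{\vec b_1}\otimes\cdots\otimes x_{\vec b_m}$ with $|\vec b_i|=k_i$. For $S\in\mathcal{S}tr(G)$ and boundary edge $e_j$, $\hat b_S(e_j)=b_S(e_j)$ if $\sigma_{v_j}(e_j)=1$ and $\vec 1-b_S(e_j)$ otherwise; $x_S=x_{\hat b_S(e_1)}\otimes\cdots\otimes x_{\hat b_S(e_m)}$. $\mathrm{cw}(S)$ is the number of closed clockwise $(i,j)$-strands and $\mathrm{ccw}(S)$ the number of counterclockwise $(i,j)$-strands (open or closed), over all $1\le i<j\le n$. The web vector is $f^\uparrow(G)=\sum_{S\in\mathcal{S}tr(G)}(-q)^{\mathrm{cw}(S)-\mathrm{ccw}(S)}x_S\in V_n(\vec k)$. **Leading term.** Let $\mathrm{seq}(\vec b)$ be the increasing sequence of positions of ones of $\vec b$. Monomials of $V_n(\vec k)$ are ordered by $\prec$, the lexicographic order on the concatenated sequences $\mathrm{seq}(\vec b_1)\cdots\mathrm{seq}(\vec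 b_m)$. The leading term $\mathrm{lt}(w)$ of nonzero $w$ is its $\prec$-smallest monomial with nonzero coefficient. A leading term stranding of $G$ is $S^\star\in\mathcal{S}tr(G)$ with $\mathrm{lt}(f^\uparrow(G))=x_{S^\star}$. **Tableaux.** When $n\mid\sum_j k_j$, a row-strict tableau of type $\vec k$ is a filling of the $n$-row rectangular Young diagram of content $\{1^{k_1},\ldots,m^{k_m}\}$ whose entries strictly increase from left to right along each row and weakly increase from top to bottom down each column; $\mathcal{RST}_n(\vec k)$ is the set of these ($\emptyset$ if $n\nmid\sum_j k_j$). For $S\in\mathcal{S}tr(G)$, the tableau $T_S$ is obtained by placing $j$ in row $c$ ($1\le c\le n$, $1\le j\le m$) exactly when $x_c$ occurs in the $j$th tensor factor of $x_S$ (i.e. $\hat b_S(e_j)_c=1$) and arranging the entries of each row in increasing order from left to right. *)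

theory Defs
  imports
    "HOL-Complex_Analysis.Winding_Numbers"
    "HOL-Library.Poly_Mapping"
    "HOL-Computational_Algebra.Polynomial"
    "HOL-Computational_Algebra.Fraction_Field"
begin

section \<open>Webs\<close>

text \<open>
  The plane is the complex plane, the boundary axis is the real line, and the closed half-plane
  below it is \<open>Im z \<le> 0\<close>. A directed weighted half-plane graph is given by a concrete embedding:
  each edge is a path, directed from \<open>pathstart\<close> to \<open>pathfinish\<close>. Parallel edges are allowed.
\<close>

record 'e wgraph =
  verts :: "complex set"
  edges :: "'e set"
  epath :: "'e \<Rightarrow> real \<Rightarrow> complex"
  weight :: "'e \<Rightarrow> nat"

definition tail :: "'e wgraph \<Rightarrow> 'e \<Rightarrow> complex" where
  "tail G e = pathstart (epath G e)"

definition head :: "'e wgraph \<Rightarrow> 'e \<Rightarrow> complex" where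
  "head G e = pathfinish (epath G e)"

definition boundary_verts :: "'e wgraph \<Rightarrow> complex set" where
  "boundary_verts G = {v \<in> verts G. Im v = 0}"

definition interior_verts :: "'e wgraph \<Rightarrow> complex set" where
  "interior_verts G = verts G - boundary_verts G"

definition halfplane_graph :: "'e wgraph \<Rightarrow> bool" where
  "halfplane_graph G \<longleftrightarrow>
     finite (verts G) \<and> finite (edges G) \<and>
     (\<forall>v\<in>verts G. Im v \<le> 0) \<and>
     (\<forall>e\<in>edges G. simple_path (epath G e) \<and>
        (\<forall>z\<in>path_image (epath G e). Im z \<le> 0 \<and> (Im z = 0 \<longrightarrow> z \<in> verts G)) \<and>
        path_image (epath G e) \<inter> verts G = {tail G e, head G e}) \<and>
     (\<forall>e\<in>edges G. \<forall>e'\<in>edges G. e \<noteq> e' \<longrightarrow>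
        path_image (epath G e) \<inter> path_image (epath G e') \<subseteq> verts G)"

text \<open>
  A dart \<open>(e, True)\<close> is the edge \<open>e\<close> traversed along its direction, \<open>(e, False)\<close> is \<open>e\<close> traversed
  against it. The half-edges at \<open>v\<close> are the darts ending at \<open>v\<close>, and the sign of such a dart is
  the number $\sigma_v(e)$.
\<close>

type_synonym 'e dart = "'e \<times> bool"

definition darts :: "'e wgraph \<Rightarrow> 'e dart set" where
  "darts G = edges G \<times> UNIV"

definition dart_src :: "'e wgraph \<Rightarrow> 'e dart \<Rightarrow> complex" where
  "dart_src G d = (if snd d then tail G (fst d) else head G (fst d))"

definition dart_tgt :: "'e wgraph \<Rightarrow> 'e dart \<Rightarrow> complex" where
  "dart_tgt G d = (if snd d then head G (fst d) else tail G (fst d))"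

definition dart_sign :: "'e dart \<Rightarrow> int" where
  "dart_sign d = (if snd d then 1 else - 1)"

definition half_edges :: "'e wgraph \<Rightarrow> complex \<Rightarrow> 'e dart set" where
  "half_edges G v = {d \<in> darts G. dart_tgt G d = v}"

definition web :: "nat \<Rightarrow> 'e wgraph \<Rightarrow> bool" where
  "web n G \<longleftrightarrow>
     halfplane_graph G \<and>
     (\<forall>e\<in>edges G. 1 \<le> weight G e \<and> weight G e \<le> n - 1) \<and>
     (\<forall>v\<in>boundary_verts G. card (half_edges G v) = 1) \<and>
     (\<forall>v\<in>interior_verts G. card (half_edges G v) = 3 \<and>
        int n dvd (\<Sum>d\<in>half_edges G v. dart_sign d * int (weight G (fst d))))"

definition bverts_list :: "'e wgraph \<Rightarrow> complex list" where
  "bverts_list G = map complex_of_real (sorted_list_of_set (Re ` boundary_verts G))"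

definition boundary_dart :: "'e wgraph \<Rightarrow> complex \<Rightarrow> 'e dart" where
  "boundary_dart G v = (THE d. d \<in> half_edges G v)"

definition boundary_weights :: "nat \<Rightarrow> 'e wgraph \<Rightarrow> nat list" where
  "boundary_weights n G =
     map (\<lambda>v. let d = boundary_dart G v; l = weight G (fst d) in
              if dart_sign d = 1 then l else n - l) (bverts_list G)"

definition webs :: "nat \<Rightarrow> nat list \<Rightarrow> 'e wgraph set" where
  "webs n k = {G. web n G \<and> boundary_weights n G = k}"

section \<open>Curves\<close>

text \<open>
  An oriented simple path, or oriented simple closed path up to the choice of its starting point,
  is determined by the set of darts it traverses; curves are represented by these sets.
\<close>

definition walk :: "'e wgraph \<Rightarrow> 'e dart list \<Rightarrow> bool" where
  "walk G ds \<longleftrightarrow> ds \<noteq> [] \<and> set ds \<subseteq> darts G \<and>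
     successively (\<lambda>d d'. dart_tgt G d = dart_src G d') ds"

definition arc_walk :: "'e wgraph \<Rightarrow> 'e dart list \<Rightarrow> bool" where
  "arc_walk G ds \<longleftrightarrow> walk G ds \<and>
     distinct (dart_src G (hd ds) # map (dart_tgt G) ds) \<and>
     dart_src G (hd ds) \<in> boundary_verts G \<and> dart_tgt G (last ds) \<in> boundary_verts G"

text \<open>
  Distinctness of the underlying edges rules out going back and forth along a single edge, while
  a pair of parallel edges does give a loop.
\<close>

definition loop_walk :: "'e wgraph \<Rightarrow> 'e dart list \<Rightarrow> bool" where
  "loop_walk G ds \<longleftrightarrow> walk G ds \<and> dart_tgt G (last ds) = dart_src G (hd ds) \<and>
     distinct (map (dart_src G) ds) \<and> distinct (map fst ds)"

definition is_arc :: "'e wgraph \<Rightarrow> 'e dart set \<Rightarrow> bool" where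
  "is_arc G C \<longleftrightarrow> (\<exists>ds. arc_walk G ds \<and> C = set ds)"

definition is_loop :: "'e wgraph \<Rightarrow> 'e dart set \<Rightarrow> bool" where
  "is_loop G C \<longleftrightarrow> (\<exists>ds. loop_walk G ds \<and> C = set ds)"

definition dart_path :: "'e wgraph \<Rightarrow> 'e dart \<Rightarrow> real \<Rightarrow> complex" where
  "dart_path G d = (if snd d then epath G (fst d) else reversepath (epath G (fst d)))"

fun walk_path :: "'e wgraph \<Rightarrow> 'e dart list \<Rightarrow> real \<Rightarrow> complex" where
  "walk_path G [] = linepath 0 0"
| "walk_path G [d] = dart_path G d"
| "walk_path G (d # d' # ds) = dart_path G d +++ walk_path G (d' # ds)"

definition ccw_loop :: "'e wgraph \<Rightarrow> 'e dart set \<Rightarrow> bool" where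
  "ccw_loop G C \<longleftrightarrow> (\<exists>ds. loop_walk G ds \<and> C = set ds \<and>
     (\<forall>z\<in>inside (path_image (walk_path G ds)). winding_number (walk_path G ds) z = 1))"

definition cw_loop :: "'e wgraph \<Rightarrow> 'e dart set \<Rightarrow> bool" where
  "cw_loop G C \<longleftrightarrow> (\<exists>ds. loop_walk G ds \<and> C = set ds \<and>
     (\<forall>z\<in>inside (path_image (walk_path G ds)). winding_number (walk_path G ds) z = - 1))"

definition ccw_arc :: "'e wgraph \<Rightarrow> 'e dart set \<Rightarrow> bool" where
  "ccw_arc G C \<longleftrightarrow> (\<exists>ds. arc_walk G ds \<and> C = set ds \<and>
     Re (dart_src G (hd ds)) < Re (dart_tgt G (last ds)))"

text \<open>
  Distinct edges of a half-plane graph meet only in vertices, so curves are disjoint as subsets of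
  the plane exactly if they have no vertex in common.
\<close>

definition curve_verts :: "'e wgraph \<Rightarrow> 'e dart set \<Rightarrow> complex set" where
  "curve_verts G C = dart_src G ` C \<union> dart_tgt G ` C"

section \<open>Strandings\<close>

text \<open>\<open>S c\<close> is the set of simple strands of colour \<open>c\<close>.\<close>

type_synonym 'e stranding = "nat \<Rightarrow> 'e dart set set"

definition stranding :: "nat \<Rightarrow> 'e wgraph \<Rightarrow> 'e stranding \<Rightarrow> bool" where
  "stranding n G S \<longleftrightarrow>
     (\<forall>c. c \<notin> {1..n - 1} \<longrightarrow> S c = {}) \<and>
     (\<forall>c. \<forall>C\<in>S c. is_arc G C \<or> is_loop G C) \<and>
     (\<forall>c. pairwise (\<lambda>C C'. curve_verts G C \<inter> curve_verts G C' = {}) (S c))"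

definition plus_colors :: "'e stranding \<Rightarrow> 'e \<Rightarrow> nat set" where
  "plus_colors S e = {c. \<exists>C\<in>S c. (e, True) \<in> C}"

definition minus_colors :: "'e stranding \<Rightarrow> 'e \<Rightarrow> nat set" where
  "minus_colors S e = {c. \<exists>C\<in>S c. (e, False) \<in> C}"

definition colors :: "'e stranding \<Rightarrow> 'e \<Rightarrow> nat set" where
  "colors S e = plus_colors S e \<union> minus_colors S e"

definition alpha :: "'e stranding \<Rightarrow> 'e \<Rightarrow> nat \<Rightarrow> int" where
  "alpha S e c =
     (if c \<in> plus_colors S e then 1 else if c \<in> minus_colors S e then - 1 else 0)"

text \<open>
  In a valid stranding every edge carries a strand: otherwise \<open>Max (colors S e)\<close> is meaningless, and
  the empty sum \<open>0\<close> is neither the weight \<open>l\<close> nor \<open>l - n\<close>.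
\<close>

definition valid_stranding :: "nat \<Rightarrow> 'e wgraph \<Rightarrow> 'e stranding \<Rightarrow> bool" where
  "valid_stranding n G S \<longleftrightarrow> stranding n G S \<and>
     (\<forall>e\<in>edges G.
        (\<forall>c\<in>colors S e. \<forall>d\<in>colors S e.
           c < d \<and> (\<forall>x. c < x \<and> x < d \<longrightarrow> x \<notin> colors S e) \<longrightarrow> alpha S e d = - alpha S e c) \<and>
        colors S e \<noteq> {} \<and>
        (\<Sum>c\<in>colors S e. alpha S e c * int c) =
          (if Max (colors S e) \<in> plus_colors S e then int (weight G e)
           else int (weight G e) - int n))"

definition Str :: "nat \<Rightarrow> 'e wgraph \<Rightarrow> 'e stranding set" where
  "Str n G = {S. valid_stranding n G S}"

text \<open>
  A binary vector $b_1\cdots b_n$ is a function \<open>nat \<Rightarrow> int\<close> vanishing outside \<open>{1..n}\<close>. The defining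
  equations $b_c - b_{c+1} = \alpha_c$, together with the value of $b_n$, are solved by
  telescoping; see the two lemmas below.
\<close>

type_synonym bvec = "nat \<Rightarrow> int"

definition bvec_of :: "nat \<Rightarrow> 'e stranding \<Rightarrow> 'e \<Rightarrow> bvec" where
  "bvec_of n S e = (\<lambda>c. if c \<in> {1..n}
     then (if Max (colors S e) \<in> plus_colors S e then 0 else 1) + (\<Sum>d = c..<n. alpha S e d)
     else 0)"

lemma bvec_of_diff:
  assumes "1 \<le> c" "c \<le> n - 1"
  shows "bvec_of n S e c - bvec_of n S e (c + 1) = alpha S e c"
proof -
  have "c < n" using assms by linarith
  then show ?thesis using assms by (simp add: bvec_of_def sum.atLeast_Suc_lessThan)
qed

lemma bvec_of_last:
  assumes "1 \<le> n"
  shows "bvec_of n S e n = (if Max (colors S e) \<in> plus_colors S e then 0 else 1)"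
  using assms by (simp add: bvec_of_def)

section \<open>\<open>(i,j)\<close>-strands\<close>

definition L :: "nat \<Rightarrow> 'e wgraph \<Rightarrow> 'e stranding \<Rightarrow> nat \<Rightarrow> nat \<Rightarrow> 'e dart set" where
  "L n G S i j =
     {(e, True) |e. e \<in> edges G \<and> bvec_of n S e i - bvec_of n S e j = 1} \<union>
     {(e, False) |e. e \<in> edges G \<and> bvec_of n S e i - bvec_of n S e j = - 1}"

definition meet_rel :: "'e wgraph \<Rightarrow> 'e dart set \<Rightarrow> ('e dart \<times> 'e dart) set" where
  "meet_rel G D = {(d, d'). d \<in> D \<and> d' \<in> D \<and> curve_verts G {d} \<inter> curve_verts G {d'} \<noteq> {}}"

text \<open>The \<open>(i,j)\<close>-strands are the connected components of \<open>L n G S i j\<close>.\<close>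

definition ij_strands :: "nat \<Rightarrow> 'e wgraph \<Rightarrow> 'e stranding \<Rightarrow> nat \<Rightarrow> nat \<Rightarrow> 'e dart set set" where
  "ij_strands n G S i j = L n G S i j // (meet_rel G (L n G S i j))\<^sup>*"

definition cw :: "nat \<Rightarrow> 'e wgraph \<Rightarrow> 'e stranding \<Rightarrow> nat" where
  "cw n G S = (\<Sum>(i, j) \<in> {(i, j). 1 \<le> i \<and> i < j \<and> j \<le> n}.
     card {C \<in> ij_strands n G S i j. cw_loop G C})"

definition ccw :: "nat \<Rightarrow> 'e wgraph \<Rightarrow> 'e stranding \<Rightarrow> nat" where
  "ccw n G S = (\<Sum>(i, j) \<in> {(i, j). 1 \<le> i \<and> i < j \<and> j \<le> n}.
     card {C \<in> ij_strands n G S i j. ccw_arc G C \<or> ccw_loop G C})"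

section \<open>The web vector and its leading term\<close>

text \<open>
  The monomial $x_{\vec b_1}\otimes\cdots\otimes x_{\vec b_m}$ is represented by the list of its
  binary vectors, and an element of $V_n(\vec k)$ by its finitely supported coefficient function.
  The monomials form a basis, so nothing else of the structure of $V_n(\vec k)$ is needed here.
\<close>

type_synonym monomial = "bvec list"
type_synonym Cq = "complex poly fract"

definition q :: Cq where
  "q = Fract [:0, 1:] 1"

definition bhat :: "nat \<Rightarrow> 'e wgraph \<Rightarrow> 'e stranding \<Rightarrow> complex \<Rightarrow> bvec" where
  "bhat n G S v = (let d = boundary_dart G v; b = bvec_of n S (fst d) in
     if dart_sign d = 1 then b else (\<lambda>c. if c \<in> {1..n} then 1 - b c else 0))"

definition xmon :: "nat \<Rightarrow> 'e wgraph \<Rightarrow> 'e stranding \<Rightarrow> monomial" where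
  "xmon n G S = map (bhat n G S) (bverts_list G)"

definition web_vector :: "nat \<Rightarrow> 'e wgraph \<Rightarrow> monomial \<Rightarrow>\<^sub>0 Cq" where
  "web_vector n G =
     (\<Sum>S\<in>Str n G. Poly_Mapping.single (xmon n G S) ((- q) powi (int (cw n G S) - int (ccw n G S))))"

definition seq :: "bvec \<Rightarrow> nat list" where
  "seq b = sorted_list_of_set {c. b c = 1}"

definition mon_less :: "monomial \<Rightarrow> monomial \<Rightarrow> bool" where
  "mon_less x y \<longleftrightarrow> (concat (map seq x), concat (map seq y)) \<in> lexord less_than"

definition is_leading_term :: "monomial \<Rightarrow> (monomial \<Rightarrow>\<^sub>0 Cq) \<Rightarrow> bool" where
  "is_leading_term x w \<longleftrightarrow>
     x \<in> Poly_Mapping.keys w \<and> (\<forall>y\<in>Poly_Mapping.keys w. y \<noteq> x \<longrightarrow> mon_less x y)"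

definition leading_term_stranding :: "nat \<Rightarrow> 'e wgraph \<Rightarrow> 'e stranding \<Rightarrow> bool" where
  "leading_term_stranding n G S \<longleftrightarrow>
     S \<in> Str n G \<and> is_leading_term (xmon n G S) (web_vector n G)"

section \<open>Tableaux\<close>

text \<open>
  A tableau is the list of its rows from top to bottom; the rectangular diagram with \<open>n\<close> rows has
  rows of length \<open>sum_list k div n\<close>.
\<close>

definition RST :: "nat \<Rightarrow> nat list \<Rightarrow> nat list list set" where
  "RST n k = {T. n dvd sum_list k \<and>
     length T = n \<and> (\<forall>row\<in>set T. length row = sum_list k div n) \<and>
     (\<forall>j. count_list (concat T) j = (if 1 \<le> j \<and> j \<le> length k then k ! (j - 1) else 0)) \<and>
     (\<forall>row\<in>set T. sorted_wrt (<) row) \<and>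
     (\<forall>r p. Suc r < n \<and> p < sum_list k div n \<longrightarrow> T ! r ! p \<le> T ! Suc r ! p)}"

definition tableau :: "nat \<Rightarrow> 'e wgraph \<Rightarrow> 'e stranding \<Rightarrow> nat list list" where
  "tableau n G S = (let x = xmon n G S in
     map (\<lambda>c. sorted_list_of_set {j. 1 \<le> j \<and> j \<le> length x \<and> (x ! (j - 1)) c = 1}) [1..<n + 1])"

end

theory Submission
  imports Defs "HOL-Computational_Algebra.Polynomial_Factorial"
begin

text \<open>
  A colour \<open>c\<close> strand is a \<open>(c, c + 1)\<close>-strand, and reversing it yields again a valid stranding, since
  validity amounts to having binary edge vectors with the right number of ones whose consecutive
  differences satisfy conservation at the interior vertices. Reversing a counterclockwise arc
  exchanges \<open>x\<^sub>c\<^sub>+\<^sub>1\<close> for \<open>x\<^sub>c\<close> at its left end, so it decreases the monomial. As no cancellation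
  occurs in the web vector (at \<open>-q = 1\<close> its coefficients count strandings), all arcs of a leading
  term stranding are clockwise. Hence in every initial segment of the boundary there are at least as
  many \<open>x\<^sub>c\<close> as \<open>x\<^sub>c\<^sub>+\<^sub>1\<close>, with equality for the whole boundary, which is the row-strict tableau
  condition.
\<close>

text \<open>Reversal cannot be carried out on the curves alone: exchanging the entries
  \<open>c\<close> and \<open>c + 1\<close> of the edge vectors along a strand also alters the
  differences at \<open>c - 1\<close> and \<open>c + 1\<close>, so the strands of the neighbouring
  colours have to be rerouted. Hence the detour through edge labellings, where reversal is an
  addition, and back. The way back needs, for each colour, a family of vertex-disjoint arcs and
  loops with prescribed net passage 1, -1 or 0 through every edge. Trivalence supplies it: three
  terms from {-1, 0, 1} sum to 0 only if all vanish or one is 1, one is -1 and one is 0, so at most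
  one curve passes through an interior vertex. Univalence does the corresponding work on the axis,
  where curves can only start or end. Different strandings may share a monomial, which is why the
  coefficients must be shown not to cancel before minimality can be tested against an arbitrary
  stranding.\<close>

definition rev_dart :: "'e dart \<Rightarrow> 'e dart" where
  "rev_dart d = (fst d, \<not> snd d)"

lemma rev_dart_simps [simp]:
  "rev_dart (rev_dart d) = d" "fst (rev_dart d) = fst d" "rev_dart d \<noteq> d"
  "rev_dart d \<in> darts G \<longleftrightarrow> d \<in> darts G"
  "dart_src G (rev_dart d) = dart_tgt G d" "dart_tgt G (rev_dart d) = dart_src G d"
  "dart_sign (rev_dart d) = - dart_sign d"
  by (cases d; auto simp: rev_dart_def darts_def dart_src_def dart_tgt_def dart_sign_def)+

lemma fst_eq_dart: "fst d = fst d' \<Longrightarrow> d' = d \<or> d' = rev_dart d"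
  by (cases d; cases d') (auto simp: rev_dart_def)

lemma web_dart_verts:
  assumes "web n G" "d \<in> darts G"
  shows "dart_src G d \<in> verts G" "dart_tgt G d \<in> verts G"
proof -
  have "path_image (epath G (fst d)) \<inter> verts G = {tail G (fst d), head G (fst d)}"
    using assms by (auto simp: web_def halfplane_graph_def darts_def)
  then have "{tail G (fst d), head G (fst d)} \<subseteq> verts G"
    by (metis Int_lower2)
  then show "dart_src G d \<in> verts G" "dart_tgt G d \<in> verts G"
    by (auto simp: dart_src_def dart_tgt_def)
qed

lemma web_finite_darts: "web n G \<Longrightarrow> finite (darts G)"
  by (simp add: web_def halfplane_graph_def darts_def)

lemma web_finite_half_edges: "web n G \<Longrightarrow> finite (half_edges G v)"
  by (rule finite_subset[OF _ web_finite_darts]) (auto simp: half_edges_def)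

lemma boundary_or_interior: "v \<in> verts G \<Longrightarrow> v \<in> boundary_verts G \<or> v \<in> interior_verts G"
  by (auto simp: interior_verts_def)

lemma boundary_half_edges:
  assumes "web n G" "v \<in> boundary_verts G"
  shows "half_edges G v = {boundary_dart G v}"
proof -
  obtain d where d: "half_edges G v = {d}"
    using assms unfolding web_def by (meson card_1_singletonE)
  then have "boundary_dart G v = d"
    unfolding boundary_dart_def by auto
  with d show ?thesis by simp
qed

lemma boundary_dart_mem:
  assumes "web n G" "v \<in> boundary_verts G"
  shows "boundary_dart G v \<in> darts G" "dart_tgt G (boundary_dart G v) = v"
  using boundary_half_edges[OF assms] unfolding half_edges_def by auto

section \<open>Balanced sets of darts\<close>

text \<open>This is the local description of a vertex-disjoint union of arcs and loops, used both
  for a single curve and for a whole colour class. Boundary vertices are exempt from the last clause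
  because arcs end there.\<close>

definition balanced :: "'e wgraph \<Rightarrow> 'e dart set \<Rightarrow> bool" where
  "balanced G D \<longleftrightarrow> D \<subseteq> darts G \<and> (\<forall>d\<in>D. rev_dart d \<notin> D) \<and>
     inj_on (dart_src G) D \<and> inj_on (dart_tgt G) D \<and>
     (\<forall>v\<in>interior_verts G. v \<in> dart_src G ` D \<longleftrightarrow> v \<in> dart_tgt G ` D)"

text \<open>By univalence, a dart leaving \<open>v\<close> and a dart arriving at \<open>v\<close>
  would be reverses of each other.\<close>

lemma balanced_boundary:
  assumes "web n G" "D \<subseteq> darts G" "\<forall>d\<in>D. rev_dart d \<notin> D" "v \<in> boundary_verts G"
    and "d \<in> D" "dart_src G d = v" "d' \<in> D" "dart_tgt G d' = v"
  shows False
proof -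
  have "rev_dart d \<in> half_edges G v" "d' \<in> half_edges G v"
    using assms by (auto simp: half_edges_def)
  then have "d' = rev_dart d"
    using boundary_half_edges[OF assms(1,4)] by auto
  with assms show False by auto
qed

lemma arc_walk_balanced:
  assumes arc: "arc_walk G ds"
  shows "balanced G (set ds)"
proof -
  have ne: "ds \<noteq> []" and sub: "set ds \<subseteq> darts G"
    and suc: "\<And>i. Suc i < length ds \<Longrightarrow> dart_tgt G (ds ! i) = dart_src G (ds ! Suc i)"
    and dist: "distinct (dart_src G (hd ds) # map (dart_tgt G) ds)"
    and b: "dart_src G (hd ds) \<in> boundary_verts G" "dart_tgt G (last ds) \<in> boundary_verts G"
    using arc unfolding arc_walk_def walk_def successively_conv_nth by auto
  \<comment> \<open>The successive vertices of the arc: dart \<open>i\<close> runs from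
    \<open>p i\<close> to \<open>p (Suc i)\<close>, and all claims reduce to injectivity of
    \<open>p\<close>.\<close>
  define p where "p i = (dart_src G (hd ds) # map (dart_tgt G) ds) ! i" for i
  have p_inj: "i = j" if "p i = p j" "i \<le> length ds" "j \<le> length ds" for i j
    using that nth_eq_iff_index_eq[OF dist] unfolding p_def by simp
  have tgt: "dart_tgt G (ds ! i) = p (Suc i)" if "i < length ds" for i
    using that by (simp add: p_def)
  have src: "dart_src G (ds ! i) = p i" if "i < length ds" for i
    using that suc ne by (cases i) (auto simp: p_def hd_conv_nth)
  have p0: "p 0 = dart_src G (hd ds)" and pl: "p (length ds) = dart_tgt G (last ds)"
    using ne by (auto simp: p_def last_conv_nth nth_Cons')
  have inj1: "inj_on (dart_src G) (set ds)"
    by (rule inj_onI) (metis in_set_conv_nth less_imp_le src p_inj)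
  have inj2: "inj_on (dart_tgt G) (set ds)"
    by (rule inj_onI) (metis in_set_conv_nth Suc_leI tgt p_inj Suc_inject)
  have rev: "rev_dart d \<notin> set ds" if d: "d \<in> set ds" for d
  proof
    assume "rev_dart d \<in> set ds"
    then obtain i j where ij: "i < length ds" "j < length ds" "d = ds ! i" "rev_dart d = ds ! j"
      using d by (metis in_set_conv_nth)
    \<comment> \<open>Injectivity of \<open>p\<close> turns these into \<open>i = Suc j\<close> and
      \<open>Suc i = j\<close>, which is absurd.\<close>
    have "p i = p (Suc j)" "p (Suc i) = p j"
      using ij src tgt rev_dart_simps(5,6) by metis+
    then show False
      using p_inj[of i "Suc j"] p_inj[of "Suc i" j] ij by simp
  qed
  have set_ds: "set ds = (!) ds ` {..<length ds}"
    by (auto simp: set_conv_nth)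
  have srcs: "dart_src G ` set ds = p ` {..<length ds}"
    unfolding set_ds image_image using src by (auto intro: image_cong)
  have tgts: "dart_tgt G ` set ds = p ` Suc ` {..<length ds}"
    unfolding set_ds image_image using tgt by (intro image_cong) auto
  have "v \<in> dart_src G ` set ds \<longleftrightarrow> v \<in> dart_tgt G ` set ds" if v: "v \<in> interior_verts G" for v
  proof -
    \<comment> \<open>Sources and targets are the same vertices except for the two ends of the arc,
      and these lie on the axis.\<close>
    have "v \<noteq> p 0" "v \<noteq> p (length ds)"
      using v b p0 pl by (auto simp: interior_verts_def)
    moreover obtain N where N: "length ds = Suc N" using ne by (cases ds) auto
    moreover have "{..<Suc N} = insert 0 (Suc ` {..<N})" by (rule lessThan_Suc_eq_insert_0)
    ultimately show ?thesis unfolding srcs tgts by (auto simp: lessThan_Suc)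
  qed
  with sub rev inj1 inj2 show ?thesis
    unfolding balanced_def by simp
qed

text \<open>In this form both the distinctness of the targets and the equality of the vertex sets
  are inherited from the sources.\<close>

lemma loop_walk_src_tgt:
  assumes loop: "loop_walk G ds"
  shows "map (dart_tgt G) ds = rotate1 (map (dart_src G) ds)"
proof -
  have ne: "ds \<noteq> []"
    and suc: "\<And>i. Suc i < length ds \<Longrightarrow> dart_tgt G (ds ! i) = dart_src G (ds ! Suc i)"
    and clo: "dart_tgt G (last ds) = dart_src G (hd ds)"
    using loop unfolding loop_walk_def walk_def successively_conv_nth by auto
  show ?thesis
  proof (rule nth_equalityI)
    fix i assume "i < length (map (dart_tgt G) ds)"
    then have i: "i < length ds" by simp
    show "map (dart_tgt G) ds ! i = rotate1 (map (dart_src G) ds) ! i"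
    proof (cases "Suc i = length ds")
      case True
      then show ?thesis
        using clo ne i by (simp add: nth_rotate1 last_conv_nth hd_conv_nth flip: True)
    next
      case False
      then show ?thesis using suc[of i] i by (simp add: nth_rotate1)
    qed
  qed simp
qed

lemma loop_walk_balanced:
  assumes loop: "loop_walk G ds"
  shows "balanced G (set ds)" "dart_src G ` set ds = dart_tgt G ` set ds"
proof -
  have sub: "set ds \<subseteq> darts G" and dist: "distinct (map (dart_src G) ds)" "distinct (map fst ds)"
    using loop unfolding loop_walk_def walk_def by auto
  note rot = loop_walk_src_tgt[OF loop]
  show eq: "dart_src G ` set ds = dart_tgt G ` set ds"
    using arg_cong[OF rot, of set] by simp
  have "distinct (map (dart_tgt G) ds)" using rot dist by simp
  then have inj: "inj_on (dart_src G) (set ds)" "inj_on (dart_tgt G) (set ds)" "inj_on fst (set ds)"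
    using dist by (auto simp: distinct_map)
  have "rev_dart d \<notin> set ds" if "d \<in> set ds" for d
    using inj_onD[OF inj(3), of d "rev_dart d"] that by (metis rev_dart_simps(2,3))
  with sub inj eq show "balanced G (set ds)"
    unfolding balanced_def by simp
qed

lemma arc_or_loop_balanced:
  "is_arc G C \<or> is_loop G C \<Longrightarrow> balanced G C"
  using arc_walk_balanced loop_walk_balanced unfolding is_arc_def is_loop_def by metis

lemma mem_curve_verts_iff:
  "v \<in> curve_verts G C \<longleftrightarrow> (\<exists>d\<in>C. dart_src G d = v \<or> dart_tgt G d = v)"
  by (auto simp: curve_verts_def)

text \<open>Two darts with equal source, equal target, or opposite direction share a vertex, so by
  disjointness they belong to the same member of \<open>F\<close>, where \<open>balanced\<close>
  already applies.\<close>

lemma balanced_Union: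
  assumes bal: "\<And>C. C \<in> F \<Longrightarrow> balanced G C"
    and disj: "pairwise (\<lambda>C C'. curve_verts G C \<inter> curve_verts G C' = {}) F"
  shows "balanced G (\<Union>F)"
proof -
  have same: "C = C'" if "C \<in> F" "C' \<in> F" "v \<in> curve_verts G C" "v \<in> curve_verts G C'" for C C' v
    using disj that unfolding pairwise_def by blast
  have cv: "dart_src G d \<in> curve_verts G C" "dart_tgt G d \<in> curve_verts G C" if "d \<in> C" for d C
    using that by (auto simp: curve_verts_def)
  have "inj_on (dart_src G) (\<Union>F)" "inj_on (dart_tgt G) (\<Union>F)"
    using same cv bal unfolding inj_on_def balanced_def by (metis UnionE)+
  moreover have "rev_dart d \<notin> \<Union>F" if "d \<in> \<Union>F" for d
    using that same cv bal unfolding balanced_def by (metis UnionE rev_dart_simps(5))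
  ultimately show ?thesis
    using bal unfolding balanced_def by (simp add: image_UN image_Union) blast
qed

text \<open>A walk with distinct sources of maximal length cannot be prolonged at either end, so it either
  closes up or joins two boundary vertices.\<close>

lemma balanced_contains_curve:
  assumes web: "web n G" and bal: "balanced G D" and ne: "D \<noteq> {}"
  shows "\<exists>C\<subseteq>D. C \<noteq> {} \<and> (is_arc G C \<or> is_loop G C)"
proof -
  have sub: "D \<subseteq> darts G" and rev: "\<forall>d\<in>D. rev_dart d \<notin> D"
    and inj_src: "inj_on (dart_src G) D" and inj_tgt: "inj_on (dart_tgt G) D"
    and int: "\<And>v. v \<in> interior_verts G \<Longrightarrow> v \<in> dart_src G ` D \<longleftrightarrow> v \<in> dart_tgt G ` D"
    using bal unfolding balanced_def by auto
  have finD: "finite D" using sub web_finite_darts[OF web] finite_subset by blast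
  define P where "P ds \<longleftrightarrow> walk G ds \<and> set ds \<subseteq> D \<and> distinct (map (dart_src G) ds)" for ds
  have len: "length ds \<le> card D" if "P ds" for ds
    using that finD unfolding P_def by (metis card_mono distinct_card distinct_map)
  obtain d0 where d0: "d0 \<in> D" using ne by blast
  have "P [d0]" using d0 sub by (auto simp: P_def walk_def)
  then obtain ds where ds: "P ds" and max: "\<And>ds'. P ds' \<Longrightarrow> length ds' \<le> length ds"
    using ex_has_greatest_nat[of P "[d0]" length "Suc (card D)"] len by (metis le_imp_less_Suc)
  have dsne: "ds \<noteq> []" and dsD: "set ds \<subseteq> D" and dist: "distinct (map (dart_src G) ds)"
    and succ: "successively (\<lambda>d d'. dart_tgt G d = dart_src G d') ds"
    using ds unfolding P_def walk_def by auto
  have suc: "\<And>i. Suc i < length ds \<Longrightarrow> dart_tgt G (ds ! i) = dart_src G (ds ! Suc i)"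
    using succ unfolding successively_conv_nth by auto
  let ?s = "dart_src G (hd ds)" and ?t = "dart_tgt G (last ds)"
  have last_nth: "last ds = ds ! (length ds - 1)" using dsne last_conv_nth by blast
  have hdD: "hd ds \<in> D" and lastD: "last ds \<in> D" using dsne dsD by auto
  have inj_nth: "i = j" if "ds ! i = ds ! j" "i < length ds" "j < length ds" for i j
    using that dist by (metis distinct_map nth_eq_iff_index_eq)
  show ?thesis
  proof (cases "?t = ?s")
    case True
    have "inj_on fst (set ds)"
      using dsD rev by (intro inj_onI) (metis fst_eq_dart subsetD)
    then have "distinct (map fst ds)" using dist by (simp add: distinct_map)
    then have "loop_walk G ds"
      using True ds unfolding loop_walk_def P_def by simp
    then show ?thesis using dsD dsne unfolding is_loop_def by blast
  next
    case False
    \<comment> \<open>If the walk came back to a vertex other than its start, the dart entering that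
      vertex and the last dart would have the same target.\<close>
    have t_new: "?t \<notin> dart_src G ` set ds"
    proof
      assume "?t \<in> dart_src G ` set ds"
      then obtain i where i: "i < length ds" "?t = dart_src G (ds ! i)"
        by (auto simp: in_set_conv_nth)
      have "i \<noteq> 0" using i False dsne by (metis hd_conv_nth)
      then obtain j where j: "i = Suc j" by (cases i) auto
      then have "dart_tgt G (ds ! j) = ?t" using suc[of j] i by simp
      then have "ds ! j = last ds"
        using inj_onD[OF inj_tgt, of "ds ! j" "last ds"] dsD i j lastD
        by (meson Suc_lessD nth_mem subsetD)
      then have "j = length ds - 1"
        using inj_nth[of j "length ds - 1"] i j last_nth by simp
      then show False using i j by simp
    qed
    have t_b: "?t \<in> boundary_verts G"
    proof (rule ccontr)
      assume "?t \<notin> boundary_verts G"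
      then have "?t \<in> interior_verts G"
        using boundary_or_interior web_dart_verts[OF web] lastD sub by blast
      then have "?t \<in> dart_src G ` D" using int lastD by simp
      then obtain d where d: "d \<in> D" "dart_src G d = ?t" by (metis imageE)
      have "P (ds @ [d])"
        using ds d t_new sub unfolding P_def walk_def
        by (auto simp: successively_append_iff image_iff)
      from max[OF this] show False by simp
    qed
    have s_b: "?s \<in> boundary_verts G"
    proof (rule ccontr)
      assume "?s \<notin> boundary_verts G"
      then have "?s \<in> interior_verts G"
        using boundary_or_interior web_dart_verts[OF web] hdD sub by blast
      then have "?s \<in> dart_tgt G ` D" using int hdD by (metis imageI)
      then obtain d where d: "d \<in> D" "dart_tgt G d = ?s" by (metis imageE)
      \<comment> \<open>Otherwise \<open>d\<close> is already on the walk; since it ends at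
        \<open>?s\<close>, either its successor repeats the source \<open>?s\<close>, or
        \<open>d\<close> is the last dart and the walk closes up.\<close>
      have "dart_src G d \<notin> dart_src G ` set ds"
      proof
        assume "dart_src G d \<in> dart_src G ` set ds"
        then have "d \<in> set ds" using inj_onD[OF inj_src] d dsD by blast
        then obtain i where i: "i < length ds" "d = ds ! i" by (metis in_set_conv_nth)
        show False
        proof (cases "Suc i < length ds")
          case True
          then have "dart_src G (ds ! Suc i) = dart_src G (ds ! 0)"
            using suc[of i] i d dsne by (simp add: hd_conv_nth)
          then show False
            using nth_eq_iff_index_eq[OF dist, of "Suc i" 0] True dsne by simp
        next
          case False
          then have "d = last ds" using i last_nth by (metis Suc_lessI diff_Suc_1)
          then show False using d \<open>?t \<noteq> ?s\<close> by simp
        qed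
      qed
      then have "P (d # ds)"
        using ds d sub dsne unfolding P_def walk_def
        by (cases ds) (auto simp: image_iff)
      from max[OF this] show False by simp
    qed
    have "inj_on (dart_tgt G) (set ds)" using inj_tgt dsD inj_on_subset by blast
    then have "distinct (map (dart_tgt G) ds)" using dist by (simp add: distinct_map)
    moreover have "?s \<notin> dart_tgt G ` set ds"
      using balanced_boundary[OF web sub rev s_b hdD refl] dsD by (metis imageE subsetD)
    ultimately have "arc_walk G ds"
      using s_b t_b ds unfolding arc_walk_def P_def by simp
    then show ?thesis using dsD dsne unfolding is_arc_def by blast
  qed
qed

text \<open>At an interior vertex \<open>C\<close> uses an incoming and an outgoing dart, and by
  injectivity \<open>D\<close> has no others there; at a boundary vertex \<open>D\<close> has at
  most one dart. This is what makes curves removed successively from \<open>D\<close>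
  disjoint.\<close>

lemma balanced_meet:
  assumes web: "web n G" and D: "balanced G D" and C: "balanced G C" "C \<subseteq> D"
  shows "curve_verts G C \<inter> curve_verts G (D - C) = {}"
proof (rule ccontr)
  assume "curve_verts G C \<inter> curve_verts G (D - C) \<noteq> {}"
  then obtain v where v: "v \<in> curve_verts G C" "v \<in> curve_verts G (D - C)" by blast
  have sub: "D \<subseteq> darts G" and rev: "\<forall>d\<in>D. rev_dart d \<notin> D"
    and inj: "inj_on (dart_src G) D" "inj_on (dart_tgt G) D"
    using D unfolding balanced_def by auto
  have vv: "v \<in> verts G"
    using v(1) C sub web_dart_verts[OF web] unfolding curve_verts_def by blast
  obtain d where d: "d \<in> C" "dart_src G d = v \<or> dart_tgt G d = v"
    using v(1) by (auto simp: mem_curve_verts_iff)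
  obtain d' where d': "d' \<in> D - C" "dart_src G d' = v \<or> dart_tgt G d' = v"
    using v(2) by (auto simp: mem_curve_verts_iff)
  note injD = inj_onD[OF inj(1)] inj_onD[OF inj(2)]
  show False
  proof (cases "v \<in> interior_verts G")
    case True
    then have "v \<in> dart_src G ` C \<longleftrightarrow> v \<in> dart_tgt G ` C"
      using C unfolding balanced_def by simp
    then obtain d1 d2 where "d1 \<in> C" "dart_src G d1 = v" "d2 \<in> C" "dart_tgt G d2 = v"
      using d by (metis imageE imageI)
    then show False using d' injD C(2) by (metis DiffE subsetD)
  next
    case False
    then have b: "v \<in> boundary_verts G" using vv boundary_or_interior by blast
    have "d \<in> D" "d' \<in> D" "d \<noteq> d'" using d d' C(2) by auto
    moreover note balanced_boundary[OF web sub rev b]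
    ultimately show False using d(2) d'(2) injD by metis
  qed
qed

lemma balanced_Diff:
  assumes D: "balanced G D" and C: "balanced G C" "C \<subseteq> D"
  shows "balanced G (D - C)"
proof -
  have inj: "inj_on (dart_src G) D" "inj_on (dart_tgt G) D"
    using D unfolding balanced_def by auto
  have "dart_src G ` (D - C) = dart_src G ` D - dart_src G ` C"
    "dart_tgt G ` (D - C) = dart_tgt G ` D - dart_tgt G ` C"
    using inj C(2) by (auto simp: inj_on_image_set_diff)
  then show ?thesis
    using assms inj unfolding balanced_def by (auto intro: inj_on_subset)
qed

lemma balanced_decomposition:
  assumes web: "web n G" and "balanced G D"
  shows "\<exists>F. \<Union>F = D \<and> (\<forall>C\<in>F. is_arc G C \<or> is_loop G C) \<and>
    pairwise (\<lambda>C C'. curve_verts G C \<inter> curve_verts G C' = {}) F"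
  using assms(2)
proof (induction "card D" arbitrary: D rule: less_induct)
  case less
  show ?case
  proof (cases "D = {}")
    case True
    then show ?thesis by (intro exI[of _ "{}"]) auto
  next
    case False
    have finD: "finite D"
      using less.prems web_finite_darts[OF web] finite_subset unfolding balanced_def by blast
    obtain C where C: "C \<subseteq> D" "C \<noteq> {}" "is_arc G C \<or> is_loop G C"
      using balanced_contains_curve[OF web less.prems False] by blast
    have balC: "balanced G C" using arc_or_loop_balanced[OF C(3)] .
    have "card (D - C) < card D" using C finD by (intro psubset_card_mono) auto
    then obtain F where F: "\<Union>F = D - C" "\<forall>C\<in>F. is_arc G C \<or> is_loop G C"
      "pairwise (\<lambda>C C'. curve_verts G C \<inter> curve_verts G C' = {}) F"
      using less.hyps balanced_Diff[OF less.prems balC C(1)] by meson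
    have "curve_verts G C \<inter> curve_verts G C' = {}" if "C' \<in> F" for C'
    proof -
      have "curve_verts G C' \<subseteq> curve_verts G (D - C)"
        using that F(1) unfolding curve_verts_def by blast
      then show ?thesis using balanced_meet[OF web less.prems balC C(1)] by blast
    qed
    then show ?thesis
      using F C by (intro exI[of _ "insert C F"]) (auto simp: pairwise_insert Int_commute)
  qed
qed

section \<open>Flows on edges and conservation at vertices\<close>

definition flow :: "'e dart set \<Rightarrow> 'e \<Rightarrow> int" where
  "flow D e = of_bool ((e, True) \<in> D) - of_bool ((e, False) \<in> D)"

lemma dart_sign_flow:
  "dart_sign d * flow D (fst d) = of_bool (d \<in> D) - of_bool (rev_dart d \<in> D)"
  by (cases d) (auto simp: dart_sign_def flow_def rev_dart_def)

text \<open>Each half-edge counts 1 if \<open>D\<close> arrives by it and -1 if \<open>D\<close>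
  leaves by its reverse; injectivity bounds both counts by one. The hypotheses stop short of
  \<open>balanced\<close> because \<open>balanced_of_flow\<close> derives the interior clause of
  \<open>balanced\<close> from this formula.\<close>

lemma sum_half_edges_flow:
  assumes web: "web n G" and sub: "D \<subseteq> darts G"
    and inj: "inj_on (dart_src G) D" "inj_on (dart_tgt G) D"
  shows "(\<Sum>d\<in>half_edges G v. dart_sign d * flow D (fst d)) =
    of_bool (v \<in> dart_tgt G ` D) - of_bool (v \<in> dart_src G ` D)"
proof -
  note fin = web_finite_half_edges[OF web, of v]
  have one: "int (card {d \<in> D. f d = v}) = of_bool (v \<in> f ` D)"
    if "inj_on f D" for f :: "'a dart \<Rightarrow> complex"
  proof (cases "v \<in> f ` D")
    case True
    then obtain d where "d \<in> D" "f d = v" by blast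
    then have "{d \<in> D. f d = v} = {d}" using that by (auto dest: inj_onD)
    with True show ?thesis by simp
  next
    case False
    then have "{d \<in> D. f d = v} = {}" by blast
    with False show ?thesis by (simp only: card.empty) simp
  qed
  have "(\<Sum>d\<in>half_edges G v. of_bool (d \<in> D)) = int (card (half_edges G v \<inter> D))"
    using fin by (simp add: of_bool_def sum.If_cases Int_def)
  also have "half_edges G v \<inter> D = {d \<in> D. dart_tgt G d = v}"
    using sub by (auto simp: half_edges_def)
  finally have 1: "(\<Sum>d\<in>half_edges G v. of_bool (d \<in> D)) = (of_bool (v \<in> dart_tgt G ` D) :: int)"
    using one[OF inj(2)] by simp
  have "(\<Sum>d\<in>half_edges G v. of_bool (rev_dart d \<in> D)) =
      int (card (half_edges G v \<inter> {d. rev_dart d \<in> D}))"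
    using fin by (simp add: of_bool_def sum.If_cases Int_def)
  also have "half_edges G v \<inter> {d. rev_dart d \<in> D} = rev_dart ` {d \<in> D. dart_src G d = v}"
  proof (intro equalityI subsetI)
    fix d assume "d \<in> half_edges G v \<inter> {d. rev_dart d \<in> D}"
    then have "rev_dart d \<in> {d \<in> D. dart_src G d = v}" by (simp add: half_edges_def)
    then show "d \<in> rev_dart ` {d \<in> D. dart_src G d = v}"
      by (metis imageI rev_dart_simps(1))
  qed (use sub in \<open>auto simp: half_edges_def\<close>)
  also have "card \<dots> = card {d \<in> D. dart_src G d = v}"
    by (intro card_image inj_onI) (metis rev_dart_simps(1))
  finally have 2: "(\<Sum>d\<in>half_edges G v. of_bool (rev_dart d \<in> D)) =
      (of_bool (v \<in> dart_src G ` D) :: int)"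
    using one[OF inj(1)] by simp
  show ?thesis
    unfolding dart_sign_flow sum_subtractf 1 2 ..
qed

lemma balanced_sum_flow:
  assumes web: "web n G" and bal: "balanced G D"
  shows "(\<Sum>d\<in>half_edges G v. dart_sign d * flow D (fst d)) =
      of_bool (v \<in> dart_tgt G ` D) - of_bool (v \<in> dart_src G ` D)"
    and "v \<in> interior_verts G \<Longrightarrow> (\<Sum>d\<in>half_edges G v. dart_sign d * flow D (fst d)) = 0"
proof -
  show 1: "(\<Sum>d\<in>half_edges G v. dart_sign d * flow D (fst d)) =
      of_bool (v \<in> dart_tgt G ` D) - of_bool (v \<in> dart_src G ` D)"
    using bal by (intro sum_half_edges_flow[OF web]) (auto simp: balanced_def)
  show "(\<Sum>d\<in>half_edges G v. dart_sign d * flow D (fst d)) = 0" if "v \<in> interior_verts G"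
    unfolding 1 using bal that by (simp add: balanced_def)
qed

text \<open>By trivalence, a flow with values in \<open>{-1, 0, 1}\<close> has at most one incoming and at most one
  outgoing unit at each vertex.\<close>

lemma balanced_of_flow:
  assumes web: "web n G" and a: "\<And>e. e \<in> edges G \<Longrightarrow> a e \<in> {-1, 0, 1 :: int}"
    and cons: "\<And>v. v \<in> interior_verts G \<Longrightarrow> (\<Sum>d\<in>half_edges G v. dart_sign d * a (fst d)) = 0"
  defines "D \<equiv> {d \<in> darts G. dart_sign d * a (fst d) = 1}"
  shows "balanced G D" and "e \<in> edges G \<Longrightarrow> flow D e = a e"
proof -
  have sub: "D \<subseteq> darts G"
    by (auto simp: D_def)
  have rev: "rev_dart d \<notin> D" if "d \<in> D" for d
    using that by (simp add: D_def)
  show flow: "flow D e = a e" if "e \<in> edges G" for e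
    using that a[OF that] by (auto simp: flow_def D_def darts_def dart_sign_def)
  \<comment> \<open>Two equal values \<open>s\<close> of modulus 1 add up to modulus 2, which the
    third half-edge, of modulus at most 1, cannot compensate.\<close>
  have no_pair: "d1 = d2"
    if "d1 \<in> half_edges G v" "d2 \<in> half_edges G v" "\<bar>s\<bar> = 1"
      "dart_sign d1 * a (fst d1) = s" "dart_sign d2 * a (fst d2) = s" for d1 d2 v s
  proof (rule ccontr)
    assume ne: "d1 \<noteq> d2"
    let ?H = "half_edges G v"
    have v: "v \<in> verts G" using that(1) web_dart_verts(2)[OF web, of d1] by (auto simp: half_edges_def)
    show False
    proof (cases "v \<in> interior_verts G")
      case False
      then have "v \<in> boundary_verts G" using v boundary_or_interior by blast
      then show False using boundary_half_edges[OF web] that ne by auto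
    next
      case True
      have fin: "finite ?H" by (rule web_finite_half_edges[OF web])
      have "card ?H = 3" using web True by (simp add: web_def)
      then have "card (?H - {d1, d2}) = 1" using that ne fin by (simp add: card_Diff_subset)
      then obtain d3 where d3: "?H - {d1, d2} = {d3}" by (meson card_1_singletonE)
      then have H: "?H = {d1, d2, d3}" and "d3 \<noteq> d1" "d3 \<noteq> d2" using that by auto
      then have "dart_sign d1 * a (fst d1) + (dart_sign d2 * a (fst d2) + dart_sign d3 * a (fst d3)) = 0"
        using cons[OF True] ne by simp
      moreover have "d3 \<in> ?H" using d3 by blast
      then have "a (fst d3) \<in> {-1, 0, 1}"
        by (intro a) (auto simp: half_edges_def darts_def)
      then have "\<bar>dart_sign d3 * a (fst d3)\<bar> \<le> 1" by (auto simp: dart_sign_def)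
      ultimately show False
        using that(3-5) by linarith
    qed
  qed
  have inj: "inj_on (dart_src G) D" "inj_on (dart_tgt G) D"
  proof -
    show "inj_on (dart_tgt G) D"
      using no_pair[where s = 1] by (auto intro!: inj_onI simp: D_def half_edges_def)
    \<comment> \<open>Darts leaving a vertex are treated through their reverses, which are
      half-edges with value -1.\<close>
    have "rev_dart d = rev_dart d'" if "d \<in> D" "d' \<in> D" "dart_src G d = dart_src G d'" for d d'
      using that by (intro no_pair[of _ "dart_src G d" _ "-1"]) (auto simp: D_def half_edges_def)
    then show "inj_on (dart_src G) D"
      by (intro inj_onI) (metis rev_dart_simps(1))
  qed
  have "v \<in> dart_src G ` D \<longleftrightarrow> v \<in> dart_tgt G ` D" if "v \<in> interior_verts G" for v
  proof -
    have "(\<Sum>d\<in>half_edges G v. dart_sign d * flow D (fst d)) =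
        (\<Sum>d\<in>half_edges G v. dart_sign d * a (fst d))"
      by (intro sum.cong refl) (auto simp: half_edges_def darts_def flow)
    also have "\<dots> = 0" by (rule cons[OF that])
    finally show ?thesis
      using sum_half_edges_flow[OF web _ inj, of v] by (auto simp: D_def of_bool_def split: if_splits)
  qed
  then show "balanced G D"
    using rev inj unfolding balanced_def by (auto simp: D_def)
qed

section \<open>Valid strandings as binary labellings\<close>

text \<open>Abel summation. The term with \<open>b (Suc m)\<close> is the origin of the correction
  \<open>- n\<close> in the weight condition of a valid stranding.\<close>

lemma sum_mult_index:
  fixes b :: "nat \<Rightarrow> int"
  shows "(\<Sum>c\<in>{1..<Suc m}. (b c - b (c + 1)) * int c) = (\<Sum>c\<in>{1..Suc m}. b c) - int (Suc m) * b (Suc m)"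
  by (induction m) (auto simp: algebra_simps)

lemma sum_telescope:
  fixes b :: "nat \<Rightarrow> int"
  assumes "c \<le> n"
  shows "(\<Sum>d = c..<n. b d - b (d + 1)) = b c - b n"
  using assms by (induction rule: dec_induct) auto

definition alternating :: "nat set \<Rightarrow> (nat \<Rightarrow> int) \<Rightarrow> bool" where
  "alternating A \<alpha> \<longleftrightarrow> (\<forall>c\<in>A. \<forall>d\<in>A.
     c < d \<and> (\<forall>x. c < x \<and> x < d \<longrightarrow> x \<notin> A) \<longrightarrow> \<alpha> d = - \<alpha> c)"

text \<open>Read from the right, the sum is steered by the next nonzero value at or after
  \<open>c\<close>: it is 1 if that value is 1 and 0 if it is -1; beyond \<open>Max A\<close> it
  keeps its initial value.\<close>

lemma alternating_partial_sums:
  fixes \<alpha> :: "nat \<Rightarrow> int"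
  defines "A \<equiv> {c. \<alpha> c \<noteq> 0}"
  assumes \<alpha>: "\<And>c. \<alpha> c \<in> {-1, 0, 1}" and A: "A \<subseteq> {1..<n}" "A \<noteq> {}"
    and alt: "alternating A \<alpha>"
    and b: "\<And>c. b c = (if \<alpha> (Max A) = 1 then 0 else 1) + (\<Sum>d = c..<n. \<alpha> d)"
    and "c \<le> n"
  shows "b c \<in> {0, 1}"
proof -
  have finA: "finite A" using A(1) finite_subset by blast
  \<comment> \<open>This refines the claim \<open>b c \<in> {0, 1}\<close>, which alone is too weak
    for an induction.\<close>
  define P where "P c \<longleftrightarrow>
     (\<forall>d\<in>A. c \<le> d \<and> (\<forall>x. c \<le> x \<and> x < d \<longrightarrow> x \<notin> A) \<longrightarrow> b c = of_bool (\<alpha> d = 1)) \<and>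
     (A \<inter> {c..} = {} \<longrightarrow> b c = of_bool (\<alpha> (Max A) \<noteq> 1))" for c
  have next_el: "\<exists>d\<in>A. c \<le> d \<and> (\<forall>x. c \<le> x \<and> x < d \<longrightarrow> x \<notin> A)" if "A \<inter> {c..} \<noteq> {}" for c
  proof -
    have fin: "finite (A \<inter> {c..})" using finA by blast
    have "Min (A \<inter> {c..}) \<in> A \<inter> {c..}" using Min_in[OF fin that] .
    moreover have "x \<notin> A" if "c \<le> x" "x < Min (A \<inter> {c..})" for x
      using Min_le[OF fin, of x] that by auto
    ultimately show ?thesis by blast
  qed
  have "P c"
    using \<open>c \<le> n\<close>
  proof (induction rule: inc_induct)
    case base
    then show ?case using A(1) by (auto simp: P_def b)
  next
    case (step m)
    have bm: "b m = \<alpha> m + b (Suc m)"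
      using step by (simp add: b sum.atLeast_Suc_lessThan)
    show ?case
    proof (cases "m \<in> A")
      case False
      then have "b m = b (Suc m)" using bm by (simp add: A_def)
      moreover have "A \<inter> {m..} = A \<inter> {Suc m..}" using False
        by (auto simp: Suc_le_eq order_le_less)
      ultimately show ?thesis using step.IH False unfolding P_def
        by (metis Suc_leD Suc_leI le_neq_implies_less)
    next
      case True
      \<comment> \<open>By alternation the next nonzero value is \<open>- \<alpha> m\<close>; if
        there is none, then \<open>m = Max A\<close> and the initial value was chosen to
        fit.\<close>
      have "b (Suc m) = of_bool (\<alpha> m = -1)"
      proof (cases "A \<inter> {Suc m..} = {}")
        case True
        have "Max A = m" using \<open>m \<in> A\<close> True finA
          by (intro Max_eqI) (auto simp: not_less_eq_eq disjoint_iff)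
        then show ?thesis
          using True step.IH \<alpha>[of m] \<open>m \<in> A\<close> by (auto simp: P_def A_def)
      next
        case False
        then obtain d where d: "d \<in> A" "Suc m \<le> d" "\<forall>x. Suc m \<le> x \<and> x < d \<longrightarrow> x \<notin> A"
          using next_el by blast
        then have "\<alpha> d = - \<alpha> m"
          using alt True unfolding alternating_def by (auto simp: Suc_le_eq)
        moreover have "b (Suc m) = of_bool (\<alpha> d = 1)" using d step.IH unfolding P_def by blast
        ultimately show ?thesis by simp
      qed
      then have "b m = of_bool (\<alpha> m = 1)" using bm \<alpha>[of m] True by (auto simp: A_def)
      moreover have "d = m" if "m \<le> d" "\<forall>x. m \<le> x \<and> x < d \<longrightarrow> x \<notin> A" for d
        using that True by (metis le_neq_implies_less order_refl)
      ultimately show ?thesis using True unfolding P_def by auto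
    qed
  qed
  then show ?thesis
  proof (cases "A \<inter> {c..} = {}")
    case False
    then obtain d where "d\<in>A" "c \<le> d" "\<forall>x. c \<le> x \<and> x < d \<longrightarrow> x \<notin> A" using next_el by blast
    with \<open>P c\<close> have "b c = of_bool (\<alpha> d = 1)" unfolding P_def by blast
    then show ?thesis by simp
  qed (use \<open>P c\<close> in \<open>auto simp: P_def\<close>)
qed

text \<open>By Abel summation the colour sum is the sum of the entries minus \<open>n * b n\<close>,
  and \<open>b n\<close> is 0 or 1 in exactly the two cases distinguished in
  \<open>sum\<close>.\<close>

lemma binary_of_alternating:
  fixes \<alpha> :: "nat \<Rightarrow> int"
  defines "A \<equiv> {c. \<alpha> c \<noteq> 0}"
  assumes A: "A \<subseteq> {1..<n}" and "n \<ge> 1"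
    and b: "\<And>c. b c = (if \<alpha> (Max A) = 1 then 0 else 1) + (\<Sum>d = c..<n. \<alpha> d)"
    and sum: "(\<Sum>c\<in>A. \<alpha> c * int c) = (if \<alpha> (Max A) = 1 then l else l - int n)"
  shows "(\<Sum>c\<in>{1..n}. b c) = l"
proof -
  obtain m where m: "n = Suc m" using \<open>n \<ge> 1\<close> by (cases n) auto
  have "(\<Sum>c\<in>A. \<alpha> c * int c) = (\<Sum>c\<in>{1..<n}. \<alpha> c * int c)"
    using A by (intro sum.mono_neutral_left) (auto simp: A_def)
  also have "\<dots> = (\<Sum>c\<in>{1..<n}. (b c - b (c + 1)) * int c)"
    by (intro sum.cong refl) (simp add: b sum.atLeast_Suc_lessThan)
  also have "\<dots> = (\<Sum>c\<in>{1..n}. b c) - int n * b n"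
    unfolding m by (rule sum_mult_index)
  finally show ?thesis using sum by (auto simp: b split: if_splits)
qed

text \<open>A binary vector is constant between consecutive jumps, so its jumps alternate in sign
  and the last one determines \<open>b n\<close>. A vector without jumps would have 0 or
  \<open>n\<close> ones, which the bounds on \<open>l\<close> exclude.\<close>

lemma alternating_of_binary:
  fixes \<alpha> :: "nat \<Rightarrow> int"
  defines "A \<equiv> {c. \<alpha> c \<noteq> 0}"
  assumes b: "\<And>c. c \<in> {1..n} \<Longrightarrow> b c \<in> {0, 1}"
    and \<alpha>: "\<And>c. c \<in> {1..<n} \<Longrightarrow> \<alpha> c = b c - b (c + 1)" "\<And>c. c \<notin> {1..<n} \<Longrightarrow> \<alpha> c = 0"
    and sum: "(\<Sum>c\<in>{1..n}. b c) = l" "0 < l" "l < int n"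
  shows "alternating A \<alpha>" "A \<noteq> {}"
    "(\<Sum>c\<in>A. \<alpha> c * int c) = (if \<alpha> (Max A) = 1 then l else l - int n)"
    "c \<in> {1..n} \<Longrightarrow> b c = (if \<alpha> (Max A) = 1 then 0 else 1) + (\<Sum>d = c..<n. \<alpha> d)"
proof -
  have A: "A \<subseteq> {1..<n}" using \<alpha>(2) unfolding A_def by blast
  then have finA: "finite A" using finite_subset by blast
  have tel: "(\<Sum>d = c..<m. \<alpha> d) = b c - b m" if "1 \<le> c" "c \<le> m" "m \<le> n" for c m
  proof -
    have "(\<Sum>d = c..<m. \<alpha> d) = (\<Sum>d = c..<m. b d - b (d + 1))"
      using that by (intro sum.cong refl \<alpha>) auto
    then show ?thesis using sum_telescope[OF that(2)] by simp
  qed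
  have const: "b c = b m" if "1 \<le> c" "c \<le> m" "m \<le> n" "A \<inter> {c..<m} = {}" for c m
  proof -
    have "(\<Sum>d = c..<m. \<alpha> d) = 0"
      using that(4) by (intro sum.neutral) (auto simp: A_def)
    then show ?thesis using tel[OF that(1-3)] by simp
  qed
  show "alternating A \<alpha>"
    unfolding alternating_def
  proof (intro ballI impI)
    fix c d assume cd: "c \<in> A" "d \<in> A" "c < d \<and> (\<forall>x. c < x \<and> x < d \<longrightarrow> x \<notin> A)"
    have in_n: "c \<in> {1..<n}" "d \<in> {1..<n}" using cd A by auto
    have "b (c + 1) = b d" using cd in_n by (intro const) (auto simp: Suc_le_eq)
    moreover have "\<alpha> c \<noteq> 0" "\<alpha> d \<noteq> 0" using cd by (auto simp: A_def)
    moreover have "b c \<in> {0, 1}" "b d \<in> {0,1}" "b (d + 1) \<in> {0, 1}" using in_n by (intro b; simp)+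
    ultimately show "\<alpha> d = - \<alpha> c" using \<alpha>(1)[OF in_n(1)] \<alpha>(1)[OF in_n(2)] by auto
  qed
  have n: "1 \<le> n" using sum by linarith
  show "A \<noteq> {}"
  proof
    assume "A = {}"
    then have "b c = b n" if "c \<in> {1..n}" for c using that by (intro const) auto
    then have "(\<Sum>c\<in>{1..n}. b c) = (\<Sum>c\<in>{1..n}. b n)" by (rule sum.cong[OF refl])
    then have "(\<Sum>c\<in>{1..n}. b c) = int n * b n" by simp
    moreover have "b n \<in> {0, 1}" using n by (intro b) auto
    ultimately show False using sum by auto
  qed
  then have M: "Max A \<in> A" using finA by simp
  then have Mn: "Max A \<in> {1..<n}" using A by blast
  have "x \<le> Max A" if "x \<in> A" for x using Max_ge[OF finA that] .
  then have "A \<inter> {Max A + 1..<n} = {}" by force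
  then have "b (Max A + 1) = b n" using Mn by (intro const) auto
  moreover have "b (Max A) \<in> {0, 1}" "b n \<in> {0, 1}" using Mn by (intro b; simp)+
  ultimately have bn: "b n = (if \<alpha> (Max A) = 1 then 0 else 1)"
    using M \<alpha>(1)[OF Mn] by (auto simp: A_def)
  show "c \<in> {1..n} \<Longrightarrow> b c = (if \<alpha> (Max A) = 1 then 0 else 1) + (\<Sum>d = c..<n. \<alpha> d)"
    unfolding bn[symmetric] using tel[of c n] by simp
  obtain m where m: "n = Suc m" using n by (cases n) auto
  have "(\<Sum>c\<in>A. \<alpha> c * int c) = (\<Sum>c\<in>{1..<n}. \<alpha> c * int c)"
    using A by (intro sum.mono_neutral_left) (auto simp: A_def)
  also have "\<dots> = (\<Sum>c\<in>{1..<n}. (b c - b (c + 1)) * int c)"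
    by (intro sum.cong refl) (simp add: \<alpha>)
  also have "\<dots> = (\<Sum>c\<in>{1..n}. b c) - int n * b n"
    unfolding m by (rule sum_mult_index)
  finally show "(\<Sum>c\<in>A. \<alpha> c * int c) = (if \<alpha> (Max A) = 1 then l else l - int n)"
    unfolding sum(1) bn by simp
qed

text \<open>Conservation is imposed on consecutive differences, not on the entries: the signed sum
  of the entries at an interior vertex is the same for all \<open>c\<close>, but it may be nonzero,
  as the weights balance only modulo \<open>n\<close>.\<close>

definition labelling :: "nat \<Rightarrow> 'e wgraph \<Rightarrow> ('e \<Rightarrow> bvec) \<Rightarrow> bool" where
  "labelling n G b \<longleftrightarrow>
     (\<forall>e\<in>edges G. (\<forall>c\<in>{1..n}. b e c \<in> {0, 1}) \<and> (\<forall>c. c \<notin> {1..n} \<longrightarrow> b e c = 0) \<and>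
        (\<Sum>c\<in>{1..n}. b e c) = int (weight G e)) \<and>
     (\<forall>v\<in>interior_verts G. \<forall>c\<in>{1..<n}.
        (\<Sum>d\<in>half_edges G v. dart_sign d * (b (fst d) c - b (fst d) (c + 1))) = 0)"

lemma colors_alpha:
  "colors S e = {c. alpha S e c \<noteq> 0}" "c \<in> plus_colors S e \<longleftrightarrow> alpha S e c = 1"
  by (auto simp: colors_def alpha_def)

lemma alpha_values: "alpha S e c \<in> {-1, 0, 1}"
  by (simp add: alpha_def)

lemma bvec_of_alpha:
  "bvec_of n S e c = (if c \<in> {1..n} then (if alpha S e (Max {c. alpha S e c \<noteq> 0}) = 1 then 0 else 1)
     + (\<Sum>d = c..<n. alpha S e d) else 0)"
  unfolding bvec_of_def colors_alpha ..

lemma valid_stranding_alpha: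
  "valid_stranding n G S \<longleftrightarrow> stranding n G S \<and>
     (\<forall>e\<in>edges G. alternating {c. alpha S e c \<noteq> 0} (alpha S e) \<and> {c. alpha S e c \<noteq> 0} \<noteq> {} \<and>
        (\<Sum>c\<in>{c. alpha S e c \<noteq> 0}. alpha S e c * int c) =
          (if alpha S e (Max {c. alpha S e c \<noteq> 0}) = 1 then int (weight G e)
           else int (weight G e) - int n))"
  unfolding valid_stranding_def colors_alpha alternating_def ..

lemma stranding_balanced:
  assumes "stranding n G S"
  shows "balanced G (\<Union>(S c))"
  using assms arc_or_loop_balanced unfolding stranding_def
  by (intro balanced_Union) blast+

text \<open>If both directions of \<open>e\<close> occurred, \<open>alpha\<close> would be 1 and
  \<open>flow\<close> 0; a balanced set excludes this.\<close>

lemma alpha_eq_flow: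
  assumes "balanced G (\<Union>(S c))"
  shows "alpha S e c = flow (\<Union>(S c)) e"
proof -
  have "\<not> ((e, True) \<in> \<Union>(S c) \<and> (e, False) \<in> \<Union>(S c))"
  proof
    assume *: "(e, True) \<in> \<Union>(S c) \<and> (e, False) \<in> \<Union>(S c)"
    have "\<forall>d\<in>\<Union>(S c). rev_dart d \<notin> \<Union>(S c)"
      using assms unfolding balanced_def by (elim conjE)
    from bspec[OF this conjunct1[OF *]] * show False
      by (simp only: rev_dart_def fst_conv snd_conv not_True_eq_False)
  qed
  then show ?thesis
    by (auto simp: alpha_def flow_def plus_colors_def minus_colors_def)
qed

lemma alpha_support:
  assumes "stranding n G S" "c \<notin> {1..<n}"
  shows "alpha S e c = 0"
proof -
  have "c \<notin> {1..n - 1}" using assms(2) by auto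
  then have "S c = {}" using assms(1) unfolding stranding_def by blast
  then show ?thesis by (simp add: alpha_def plus_colors_def minus_colors_def)
qed

lemma labelling_of_stranding:
  assumes web: "web n G" and n: "n \<ge> 1" and S: "S \<in> Str n G"
  shows "labelling n G (bvec_of n S)"
proof -
  have str: "stranding n G S" and val: "valid_stranding n G S"
    using S by (auto simp: Str_def valid_stranding_def)
  have *: "(\<forall>c\<in>{1..n}. bvec_of n S e c \<in> {0, 1}) \<and> (\<Sum>c\<in>{1..n}. bvec_of n S e c) = int (weight G e)"
    if e: "e \<in> edges G" for e
  proof -
    let ?\<alpha> = "alpha S e" and ?A = "{c. alpha S e c \<noteq> 0}"
    define b where "b c = (if ?\<alpha> (Max ?A) = 1 then 0 else 1) + (\<Sum>d = c..<n. ?\<alpha> d)" for c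
    have A: "?A \<subseteq> {1..<n}" using alpha_support[OF str] by blast
    have v: "alternating ?A ?\<alpha>" "?A \<noteq> {}" "(\<Sum>c\<in>?A. ?\<alpha> c * int c) =
        (if ?\<alpha> (Max ?A) = 1 then int (weight G e) else int (weight G e) - int n)"
      using val e unfolding valid_stranding_alpha by auto
    have eq: "bvec_of n S e c = b c" if "c \<in> {1..n}" for c
      using that by (simp add: bvec_of_alpha b_def)
    have "b c \<in> {0, 1}" if "c \<le> n" for c
      using alternating_partial_sums[OF alpha_values A v(2,1) b_def that] .
    moreover have "(\<Sum>c\<in>{1..n}. b c) = int (weight G e)"
      using binary_of_alternating[OF A n b_def v(3)] .
    ultimately show ?thesis by (simp add: eq)
  qed
  have "(\<Sum>d\<in>half_edges G v. dart_sign d * (bvec_of n S (fst d) c - bvec_of n S (fst d) (c + 1))) = 0"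
    if "v \<in> interior_verts G" "c \<in> {1..<n}" for v c
  proof -
    have bal: "balanced G (\<Union>(S c))" by (rule stranding_balanced[OF str])
    have "bvec_of n S e c - bvec_of n S e (c + 1) = flow (\<Union>(S c)) e" for e
      using that alpha_eq_flow[of G S c, OF bal] by (subst bvec_of_diff) auto
    then show ?thesis using balanced_sum_flow(2)[OF web bal that(1)] by simp
  qed
  with * show ?thesis unfolding labelling_def by (auto simp: bvec_of_def)
qed

text \<open>The differences of consecutive entries form one conserved flow per colour; its darts are
  balanced and decompose into the strands of that colour.\<close>

lemma stranding_of_labelling:
  assumes web: "web n G" and lab: "labelling n G b"
  shows "\<exists>S\<in>Str n G. \<forall>e\<in>edges G. bvec_of n S e = b e"
proof -
  \<comment> \<open>The cutoff matters: as \<open>b\<close> vanishes outside \<open>{1..n}\<close>,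
    the raw differences at 0 and \<open>n\<close> would be \<open>- b e 1\<close> and
    \<open>b e n\<close>, though these are not colours.\<close>
  define a where "a c e = (if c \<in> {1..<n} then b e c - b e (c + 1) else 0)" for c e
  define D where "D c = {d \<in> darts G. dart_sign d * a c (fst d) = 1}" for c
  have a_outside: "a c e = 0" if "c \<notin> {1..<n}" for c e
    using that unfolding a_def by (simp only: if_False)
  have bin: "b e c \<in> {0, 1}" if "e \<in> edges G" "c \<in> {1..n}" for e c
    using lab that unfolding labelling_def by blast
  have a: "a c e \<in> {-1, 0, 1}" if "e \<in> edges G" for c e
    using bin[OF that, of c] bin[OF that, of "c + 1"] by (auto simp: a_def)
  have cons: "(\<Sum>d\<in>half_edges G v. dart_sign d * a c (fst d)) = 0" if "v \<in> interior_verts G" for c v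
  proof (cases "c \<in> {1..<n}")
    case True
    then show ?thesis using lab that unfolding labelling_def by (simp add: a_def)
  next
    case False
    then have "a c e = 0" for e by (rule a_outside)
    then show ?thesis by simp
  qed
  note D = balanced_of_flow[of n G "a c" for c, OF web a cons, folded D_def]
  have "\<exists>F. \<Union>F = D c \<and> (\<forall>C\<in>F. is_arc G C \<or> is_loop G C) \<and>
      pairwise (\<lambda>C C'. curve_verts G C \<inter> curve_verts G C' = {}) F" for c
    using balanced_decomposition[OF web D(1)] .
  then obtain F where F: "\<And>c. \<Union>(F c) = D c" "\<And>c. \<forall>C\<in>F c. is_arc G C \<or> is_loop G C"
      "\<And>c. pairwise (\<lambda>C C'. curve_verts G C \<inter> curve_verts G C' = {}) (F c)"
    by metis
  define S where "S c = (if c \<in> {1..n - 1} then F c else {})" for c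
  have D_empty: "D c = {}" if "c \<notin> {1..n - 1}" for c
  proof -
    have "c \<notin> {1..<n}" using that by auto
    then have "a c e = 0" for e by (rule a_outside)
    then show ?thesis by (simp add: D_def)
  qed
  have US: "\<Union>(S c) = D c" for c using F(1) D_empty by (simp add: S_def)
  have str: "stranding n G S"
    using F(2,3) unfolding stranding_def S_def by simp
  have alpha: "alpha S e c = a c e" if "e \<in> edges G" for e c
    using alpha_eq_flow[of G S c] D that unfolding US by simp
  have *: "alternating {c. alpha S e c \<noteq> 0} (alpha S e) \<and> {c. alpha S e c \<noteq> 0} \<noteq> {} \<and>
        (\<Sum>c\<in>{c. alpha S e c \<noteq> 0}. alpha S e c * int c) =
          (if alpha S e (Max {c. alpha S e c \<noteq> 0}) = 1 then int (weight G e)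
           else int (weight G e) - int n) \<and> bvec_of n S e = b e" if e: "e \<in> edges G" for e
  proof -
    have 1: "alpha S e c = b e c - b e (c + 1)" if "c \<in> {1..<n}" for c
      using that e by (simp add: alpha a_def)
    have 2: "alpha S e c = 0" if "c \<notin> {1..<n}" for c
      using a_outside[OF that] e by (simp only: alpha)
    have "1 \<le> weight G e \<and> weight G e \<le> n - 1" using web e by (simp add: web_def)
    then have 4: "0 < int (weight G e)" "int (weight G e) < int n" by auto
    have 3: "(\<Sum>c\<in>{1..n}. b e c) = int (weight G e)" "\<And>c. c \<notin> {1..n} \<Longrightarrow> b e c = 0"
      using lab e unfolding labelling_def by auto
    note alt = alternating_of_binary[OF bin[OF e] 1 2 3(1) 4]
    have "bvec_of n S e = b e"
      using alt(4) 3(2) unfolding bvec_of_alpha fun_eq_iff by auto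
    then show ?thesis using alt(1-3) by blast
  qed
  then have "S \<in> Str n G"
    unfolding Str_def valid_stranding_alpha using str by simp
  with * show ?thesis by blast
qed

section \<open>The support of the web vector\<close>

text \<open>After multiplication by a power of \<open>-q\<close> the sum becomes a polynomial in \<open>-q\<close>, whose value at
  \<open>-q = 1\<close> is the number of summands.\<close>

lemma sum_powi_q_nonzero:
  assumes "finite A" "A \<noteq> {}"
  shows "(\<Sum>a\<in>A. (- q) powi f a) \<noteq> 0"
proof
  assume 0: "(\<Sum>a\<in>A. (- q) powi f a) = 0"
  \<comment> \<open>A common shift that makes all exponents nonnegative.\<close>
  define N where "N = (\<Sum>a\<in>A. nat \<bar>f a\<bar>)"
  define g where "g a = nat (f a + int N)" for a
  have g: "int (g a) = f a + int N" if "a \<in> A" for a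
  proof -
    have "nat \<bar>f a\<bar> \<le> N" unfolding N_def using assms(1) that by (intro member_le_sum) auto
    then show ?thesis by (simp add: g_def)
  qed
  have q: "- q = to_fract [:0, -1:]"
    by (simp add: q_def to_fract_def)
  then have q0: "- q \<noteq> 0" by (simp only: to_fract_eq_0_iff) simp
  have to_fract_power: "to_fract (p ^ k) = to_fract p ^ k" for p :: "complex poly" and k
    by (induction k) simp_all
  have "to_fract (\<Sum>a\<in>A. [:0, -1:] ^ g a) = (\<Sum>a\<in>A. (- q) ^ g a)"
    unfolding q by (simp add: to_fract_power)
  also have "\<dots> = (\<Sum>a\<in>A. (- q) powi f a * (- q) ^ N)"
  proof (rule sum.cong[OF refl])
    fix a assume a: "a \<in> A"
    have "(- q) ^ g a = (- q) powi (f a + int N)"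
      unfolding g[OF a, symmetric] by (rule power_int_of_nat[symmetric])
    also have "\<dots> = (- q) powi f a * (- q) ^ N"
      using q0 by (subst power_int_add) simp_all
    finally show "(- q) ^ g a = (- q) powi f a * (- q) ^ N" .
  qed
  also have "\<dots> = 0" unfolding sum_distrib_right[symmetric] 0 by simp
  finally have "(\<Sum>a\<in>A. [:0, -1:] ^ g a) = (0 :: complex poly)" by (simp only: to_fract_eq_0_iff)
  \<comment> \<open>Since \<open>- q\<close> is the polynomial \<open>- X\<close>, the value 1 of
    \<open>- q\<close> is attained at \<open>X = -1\<close>.\<close>
  then have "poly (\<Sum>a\<in>A. [:0, -1:] ^ g a) (-1 :: complex) = 0" by simp
  then have "of_nat (card A) = (0 :: complex)" by (simp add: poly_sum poly_power)
  then show False using assms by simp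
qed

lemma keys_web_vector:
  assumes "x \<in> Poly_Mapping.keys (web_vector n G)" "S \<in> Str n G"
  shows "xmon n G S \<in> Poly_Mapping.keys (web_vector n G)"
proof -
  \<comment> \<open>Finiteness comes from the existence of the key \<open>x\<close>: a sum over an
    infinite set is 0 by convention and has no keys.\<close>
  have fin: "finite (Str n G)"
  proof (rule ccontr)
    assume "infinite (Str n G)"
    then have "web_vector n G = 0" unfolding web_vector_def by (rule sum.infinite)
    then show False using assms(1) by simp
  qed
  let ?c = "\<lambda>S. (- q) powi (int (cw n G S) - int (ccw n G S))"
  have "Poly_Mapping.lookup (web_vector n G) (xmon n G S) =
      (\<Sum>T\<in>Str n G. if xmon n G T = xmon n G S then ?c T else 0)"
    unfolding web_vector_def lookup_sum by (intro sum.cong refl) (simp add: lookup_single when_def)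
  also have "\<dots> = (\<Sum>T\<in>{T \<in> Str n G. xmon n G T = xmon n G S}. ?c T)"
    using fin by (simp add: sum.inter_filter)
  also have "\<dots> \<noteq> 0" using fin assms(2) by (intro sum_powi_q_nonzero) auto
  finally show ?thesis by (simp add: in_keys_iff)
qed

lemma leading_term_minimal:
  assumes S: "leading_term_stranding n G S" and T: "T \<in> Str n G"
  shows "\<not> mon_less (xmon n G T) (xmon n G S)"
proof
  assume less: "mon_less (xmon n G T) (xmon n G S)"
  have irr: "\<not> mon_less x x" for x
    unfolding mon_less_def by (intro lexord_irreflexive) simp
  have lt: "is_leading_term (xmon n G S) (web_vector n G)"
    using S unfolding leading_term_stranding_def by blast
  then have "xmon n G T \<in> Poly_Mapping.keys (web_vector n G)"
    using keys_web_vector T unfolding is_leading_term_def by blast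
  then have "mon_less (xmon n G S) (xmon n G T)"
    using lt irr less unfolding is_leading_term_def by metis
  with less have "mon_less (xmon n G S) (xmon n G S)"
    unfolding mon_less_def by (metis lexord_trans trans_less_than)
  then show False using irr by blast
qed

section \<open>Boundary vectors\<close>

text \<open>Net flow towards the axis: 1 at the terminal and -1 at the initial vertex of an arc,
  whatever the direction of the boundary edge.\<close>

definition bd_flow :: "'e wgraph \<Rightarrow> 'e dart set \<Rightarrow> complex \<Rightarrow> int" where
  "bd_flow G D v = of_bool (v \<in> dart_tgt G ` D) - of_bool (v \<in> dart_src G ` D)"

lemma boundary_dart_flow:
  assumes web: "web n G" and bal: "balanced G D" and v: "v \<in> boundary_verts G"
  shows "dart_sign (boundary_dart G v) * flow D (fst (boundary_dart G v)) = bd_flow G D v"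
  using balanced_sum_flow(1)[OF web bal, of v]
  unfolding boundary_half_edges[OF web v] bd_flow_def by simp

lemma bhat_eq:
  "bhat n G S v i = (if i \<in> {1..n} then (if dart_sign (boundary_dart G v) = 1
     then bvec_of n S (fst (boundary_dart G v)) i else 1 - bvec_of n S (fst (boundary_dart G v)) i) else 0)"
  by (simp add: bhat_def Let_def bvec_of_def)

lemma dart_sign_cases: "dart_sign d = 1 \<or> dart_sign d = -1"
  by (simp add: dart_sign_def)

text \<open>For the last claim: complementing the vector of an outgoing edge negates its
  differences, just as passing from flow along the edge to flow into \<open>v\<close> changes the
  sign.\<close>

lemma bhat_props:
  assumes web: "web n G" and n: "n \<ge> 1" and S: "S \<in> Str n G" and v: "v \<in> boundary_verts G"
  shows "bhat n G S v i \<in> {0, 1}"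
    and "(\<Sum>i\<in>{1..n}. bhat n G S v i) = int (if dart_sign (boundary_dart G v) = 1
      then weight G (fst (boundary_dart G v)) else n - weight G (fst (boundary_dart G v)))"
    and "c \<in> {1..<n} \<Longrightarrow> bhat n G S v c - bhat n G S v (c + 1) = bd_flow G (\<Union>(S c)) v"
proof -
  let ?d = "boundary_dart G v"
  let ?b = "bvec_of n S (fst ?d)"
  have e: "fst ?d \<in> edges G"
    using boundary_dart_mem(1)[OF web v] by (auto simp: darts_def)
  have bin: "\<forall>c\<in>{1..n}. ?b c \<in> {0, 1}" and sum: "(\<Sum>c\<in>{1..n}. ?b c) = int (weight G (fst ?d))"
    using labelling_of_stranding[OF web n S] e unfolding labelling_def by blast+
  have w: "weight G (fst ?d) \<le> n" using web e unfolding web_def by force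
  show "bhat n G S v i \<in> {0, 1}" using bin by (auto simp: bhat_eq)
  show "(\<Sum>i\<in>{1..n}. bhat n G S v i) =
      int (if dart_sign ?d = 1 then weight G (fst ?d) else n - weight G (fst ?d))"
    using sum w by (simp add: bhat_eq sum_subtractf of_nat_diff)
  show "bhat n G S v c - bhat n G S v (c + 1) = bd_flow G (\<Union>(S c)) v" if c: "c \<in> {1..<n}"
  proof -
    have bal: "balanced G (\<Union>(S c))"
      using stranding_balanced S unfolding Str_def valid_stranding_def by blast
    have "?b c - ?b (c + 1) = flow (\<Union>(S c)) (fst ?d)"
      using c alpha_eq_flow[of G S c, OF bal] by (subst bvec_of_diff) auto
    then have "bd_flow G (\<Union>(S c)) v = dart_sign ?d * (?b c - ?b (c + 1))"
      using boundary_dart_flow[OF web bal v] by simp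
    then show ?thesis
      using c dart_sign_cases[of ?d] by (auto simp: bhat_eq)
  qed
qed

section \<open>Reversing a strand\<close>

text \<open>Reversing the simple strand \<open>C\<close> of colour \<open>c\<close>, which is also a \<open>(c, c + 1)\<close>-strand, amounts
  to exchanging the entries \<open>c\<close> and \<open>c + 1\<close> of the binary vectors along \<open>C\<close>.\<close>

lemma labelling_reverse:
  assumes web: "web n G" and n: "n \<ge> 1" and S: "S \<in> Str n G" and C: "C \<in> S c" and c: "c \<in> {1..<n}"
  shows "labelling n G (\<lambda>e i. bvec_of n S e i + flow C e * (of_bool (i = c + 1) - of_bool (i = c)))"
proof -
  let ?b = "bvec_of n S" and ?D = "\<Union>(S c)"
  define t :: "nat \<Rightarrow> int" where "t i = of_bool (i = c + 1) - of_bool (i = c)" for i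
  have str: "stranding n G S" using S by (auto simp: Str_def valid_stranding_def)
  have balD: "balanced G ?D" by (rule stranding_balanced[OF str])
  have balC: "balanced G C"
    using str C arc_or_loop_balanced unfolding stranding_def by blast
  have lab: "labelling n G ?b" by (rule labelling_of_stranding[OF web n S])
  have alpha: "?b e c - ?b e (c + 1) = flow ?D e" for e
    using c alpha_eq_flow[of G S c, OF balD] by (subst bvec_of_diff) auto
  \<comment> \<open>Thus \<open>flow C e\<close> is nonzero only where entries \<open>c\<close> and
    \<open>c + 1\<close> differ, with the sign for which adding \<open>flow C e * t\<close>
    exchanges them.\<close>
  have flow_cases: "flow C e = 0 \<or> flow C e = flow ?D e" for e
  proof -
    have rev: "rev_dart d \<notin> ?D" if "d \<in> C" for d
      using balD that C unfolding balanced_def by blast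
    have "(e, False) \<notin> ?D" if "(e, True) \<in> C" using rev[OF that] unfolding rev_dart_def by simp
    moreover have "(e, True) \<notin> ?D" if "(e, False) \<in> C" using rev[OF that] unfolding rev_dart_def by simp
    moreover have "d \<in> ?D" if "d \<in> C" for d using that C by blast
    ultimately show ?thesis unfolding flow_def by (metis of_bool_eq(1) diff_self)
  qed
  have edge: "(\<forall>i\<in>{1..n}. ?b e i + flow C e * t i \<in> {0, 1}) \<and>
      (\<forall>i. i \<notin> {1..n} \<longrightarrow> ?b e i + flow C e * t i = 0) \<and>
      (\<Sum>i\<in>{1..n}. ?b e i + flow C e * t i) = int (weight G e)" if e: "e \<in> edges G" for e
  proof -
    have b: "\<forall>i\<in>{1..n}. ?b e i \<in> {0, 1}" "\<forall>i. i \<notin> {1..n} \<longrightarrow> ?b e i = 0"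
      "(\<Sum>i\<in>{1..n}. ?b e i) = int (weight G e)"
      using lab e unfolding labelling_def by blast+
    have "?b e c \<in> {0, 1}" "?b e (c + 1) \<in> {0, 1}" using b(1) c by auto
    then have "?b e i + flow C e * t i \<in> {0, 1}" if "i \<in> {1..n}" for i
      using flow_cases[of e] alpha[of e] b(1) that by (auto simp: t_def)
    moreover have "t i = 0" if "i \<notin> {1..n}" for i using that c by (auto simp: t_def)
    moreover have "(\<Sum>i\<in>{1..n}. t i) = 0"
      using c by (simp add: t_def sum_subtractf of_bool_def)
    then have "(\<Sum>i\<in>{1..n}. ?b e i + flow C e * t i) = int (weight G e)"
      using b(3) by (simp add: sum.distrib flip: sum_distrib_left)
    ultimately show ?thesis using b(2) by simp
  qed
  have "(\<Sum>d\<in>half_edges G v. dart_sign d * ((?b (fst d) i + flow C (fst d) * t i) -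
      (?b (fst d) (i + 1) + flow C (fst d) * t (i + 1)))) = 0"
    if v: "v \<in> interior_verts G" and i: "i \<in> {1..<n}" for v i
  proof -
    have "(\<Sum>d\<in>half_edges G v. dart_sign d * ((?b (fst d) i + flow C (fst d) * t i) -
        (?b (fst d) (i + 1) + flow C (fst d) * t (i + 1)))) =
      (\<Sum>d\<in>half_edges G v. dart_sign d * (?b (fst d) i - ?b (fst d) (i + 1))) +
      (t i - t (i + 1)) * (\<Sum>d\<in>half_edges G v. dart_sign d * flow C (fst d))"
      unfolding sum_distrib_left sum.distrib[symmetric]
      by (intro sum.cong refl) (simp add: algebra_simps)
    moreover have "(\<Sum>d\<in>half_edges G v. dart_sign d * (?b (fst d) i - ?b (fst d) (i + 1))) = 0"
      using lab v i unfolding labelling_def by blast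
    ultimately show ?thesis using balanced_sum_flow(2)[OF web balC v] by simp
  qed
  with edge show ?thesis unfolding labelling_def t_def[symmetric] by blast
qed

lemma reverse_strand:
  assumes web: "web n G" and n: "n \<ge> 1" and S: "S \<in> Str n G" and C: "C \<in> S c" and c: "c \<in> {1..<n}"
  shows "\<exists>T\<in>Str n G. \<forall>v\<in>boundary_verts G. \<forall>i.
    bhat n G T v i = bhat n G S v i + bd_flow G C v * (of_bool (i = c + 1) - of_bool (i = c))"
proof -
  have balC: "balanced G C"
    using S C arc_or_loop_balanced unfolding Str_def valid_stranding_def stranding_def by blast
  obtain T where T: "T \<in> Str n G" "\<forall>e\<in>edges G. bvec_of n T e =
      (\<lambda>i. bvec_of n S e i + flow C e * (of_bool (i = c + 1) - of_bool (i = c)))"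
    using stranding_of_labelling[OF web labelling_reverse[OF assms]] by blast
  have "bhat n G T v i = bhat n G S v i + bd_flow G C v * (of_bool (i = c + 1) - of_bool (i = c))"
    if v: "v \<in> boundary_verts G" for v i
  proof -
    let ?d = "boundary_dart G v"
    have "fst ?d \<in> edges G"
      using boundary_dart_mem(1)[OF web v] by (auto simp: darts_def)
    then have "bvec_of n T (fst ?d) i =
        bvec_of n S (fst ?d) i + flow C (fst ?d) * (of_bool (i = c + 1) - of_bool (i = c))"
      using T(2) by simp
    moreover have "bd_flow G C v = dart_sign ?d * flow C (fst ?d)"
      using boundary_dart_flow[OF web balC v] by simp
    ultimately show ?thesis
      using c dart_sign_cases[of ?d] by (auto simp: bhat_eq)
  qed
  with T(1) show ?thesis by blast
qed

text \<open>An arc cannot pass through a univalent vertex, so it meets the axis only in its two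
  ends.\<close>

lemma arc_walk_ends:
  assumes web: "web n G" and arc: "arc_walk G ds" and v: "v \<in> boundary_verts G"
  shows "v \<in> dart_src G ` set ds \<longleftrightarrow> v = dart_src G (hd ds)"
    and "v \<in> dart_tgt G ` set ds \<longleftrightarrow> v = dart_tgt G (last ds)"
proof -
  have ne: "ds \<noteq> []" and sub: "set ds \<subseteq> darts G"
    and suc: "\<And>i. Suc i < length ds \<Longrightarrow> dart_tgt G (ds ! i) = dart_src G (ds ! Suc i)"
    using arc unfolding arc_walk_def walk_def successively_conv_nth by auto
  have rev: "\<forall>d\<in>set ds. rev_dart d \<notin> set ds"
    using arc_walk_balanced[OF arc] unfolding balanced_def by blast
  have no: "dart_src G (ds ! Suc i) \<noteq> v" "dart_tgt G (ds ! i) \<noteq> v" if i: "Suc i < length ds" for i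
    using balanced_boundary[OF web sub rev v, of "ds ! Suc i" "ds ! i"] suc[OF i] i by auto
  have hd_in: "hd ds \<in> set ds" and last_in: "last ds \<in> set ds" using ne by auto
  show "v \<in> dart_src G ` set ds \<longleftrightarrow> v = dart_src G (hd ds)"
  proof
    assume "v \<in> dart_src G ` set ds"
    then obtain d where d: "d \<in> set ds" "v = dart_src G d" by (rule imageE)
    then obtain i where i: "i < length ds" "ds ! i = d" by (metis in_set_conv_nth)
    then have "i = 0" using no(1) d by (metis not0_implies_Suc)
    then show "v = dart_src G (hd ds)" using i d ne by (simp add: hd_conv_nth)
  next
    show "v = dart_src G (hd ds) \<Longrightarrow> v \<in> dart_src G ` set ds" by (simp add: hd_in)
  qed
  show "v \<in> dart_tgt G ` set ds \<longleftrightarrow> v = dart_tgt G (last ds)"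
  proof
    assume "v \<in> dart_tgt G ` set ds"
    then obtain d where d: "d \<in> set ds" "v = dart_tgt G d" by (rule imageE)
    then obtain i where i: "i < length ds" "ds ! i = d" by (metis in_set_conv_nth)
    then have "Suc i = length ds" using no(2) d by (metis Suc_lessI)
    then have "i = length ds - 1" by simp
    then show "v = dart_tgt G (last ds)" using i d ne by (simp add: last_conv_nth)
  next
    show "v = dart_tgt G (last ds) \<Longrightarrow> v \<in> dart_tgt G ` set ds" by (simp add: last_in)
  qed
qed

section \<open>Comparison of monomials in the lexicographic order\<close>

lemma bverts_list:
  assumes "web n G"
  shows "set (bverts_list G) = boundary_verts G" "sorted_wrt (\<lambda>v w. Re v < Re w) (bverts_list G)"
    "distinct (bverts_list G)"
proof -
  have fin: "finite (Re ` boundary_verts G)"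
    using assms by (simp add: web_def halfplane_graph_def boundary_verts_def)
  have "complex_of_real (Re v) = v" if "v \<in> boundary_verts G" for v
    using that by (simp add: boundary_verts_def complex_eq_iff)
  then show "set (bverts_list G) = boundary_verts G"
    using fin by (simp add: bverts_list_def image_image)
  show *: "sorted_wrt (\<lambda>v w. Re v < Re w) (bverts_list G)"
    by (simp add: bverts_list_def sorted_wrt_map)
  have "sorted_wrt (\<noteq>) (bverts_list G)"
    by (rule sorted_wrt_mono_rel[OF _ *]) auto
  then show "distinct (bverts_list G)" by (simp add: distinct_conv_nth sorted_wrt_iff_nth_less) (metis nat_neq_iff)
qed

lemma sorted_list_of_set_split:
  fixes A B :: "nat set"
  assumes "finite A" "finite B" "\<forall>a\<in>A. a < c" "\<forall>b\<in>B. c < b"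
  shows "sorted_list_of_set (A \<union> {c} \<union> B) = sorted_list_of_set A @ c # sorted_list_of_set B"
proof (rule strict_sorted_equal)
  show "sorted_wrt (<) (sorted_list_of_set A @ c # sorted_list_of_set B)"
    using assms by (fastforce simp: sorted_wrt_append intro: less_trans)
  have "finite (A \<union> {c} \<union> B)" using assms by simp
  then show "set (sorted_list_of_set (A \<union> {c} \<union> B)) =
      set (sorted_list_of_set A @ c # sorted_list_of_set B)"
    using assms by (simp only: set_sorted_list_of_set set_append list.set) blast
qed (rule strict_sorted_list_of_set)

text \<open>The factors left of \<open>?u\<close> do not change, so the factor at \<open>?u\<close>
  decides the order; the opposite exchange at \<open>?w\<close> comes later.\<close>

lemma ccw_arc_not_minimal:
  assumes web: "web n G" and n: "n \<ge> 1" and S: "S \<in> Str n G" and C: "set ds \<in> S c"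
    and c: "c \<in> {1..<n}" and arc: "arc_walk G ds"
    and ccw: "Re (dart_src G (hd ds)) < Re (dart_tgt G (last ds))"
  shows "\<exists>T\<in>Str n G. mon_less (xmon n G T) (xmon n G S)"
proof -
  let ?u = "dart_src G (hd ds)" and ?w = "dart_tgt G (last ds)"
  obtain T where T: "T \<in> Str n G" and bhat: "\<And>v i. v \<in> boundary_verts G \<Longrightarrow>
      bhat n G T v i = bhat n G S v i + bd_flow G (set ds) v * (of_bool (i = c + 1) - of_bool (i = c))"
    using reverse_strand[OF web n S C c] by blast
  have u: "?u \<in> boundary_verts G" using arc by (simp add: arc_walk_def)
  have bd: "bd_flow G (set ds) v = of_bool (v = ?w) - of_bool (v = ?u)" if "v \<in> boundary_verts G" for v
    unfolding bd_flow_def arc_walk_ends[OF web arc that] ..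
  have uw: "?u \<noteq> ?w" using ccw by auto
  have same: "bhat n G T v = bhat n G S v" if "v \<in> boundary_verts G" "Re v < Re ?u" for v
  proof -
    have "v \<noteq> ?u" "v \<noteq> ?w" using that ccw by auto
    then show ?thesis using bhat bd that by (simp add: fun_eq_iff)
  qed
  have at_u: "bhat n G T ?u i = bhat n G S ?u i + (of_bool (i = c) - of_bool (i = c + 1))" for i
    using bhat[OF u, of i] bd[OF u] uw by simp
  note S_bin = bhat_props(1)[OF web n S u] and T_bin = bhat_props(1)[OF web n T u]
  \<comment> \<open>An entry of a binary vector can grow by 1 only from 0 and drop by 1 only from
    1.\<close>
  have Sc: "bhat n G S ?u c = 0" "bhat n G S ?u (c + 1) = 1"
    "bhat n G T ?u c = 1" "bhat n G T ?u (c + 1) = 0"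
    using S_bin[of c] S_bin[of "c + 1"] T_bin[of c] T_bin[of "c + 1"] at_u[of c] at_u[of "c + 1"] by auto
  \<comment> \<open>No integer lies between \<open>c\<close> and \<open>c + 1\<close>, so the
    exchanged entry keeps its position in the increasing sequence.\<close>
  define A where "A = {i. i < c \<and> bhat n G S ?u i = 1}"
  define B where "B = {i. c + 1 < i \<and> bhat n G S ?u i = 1}"
  have fin: "finite A" "finite B"
    by (rule finite_subset[of _ "{1..n}"]; auto simp: A_def B_def bhat_eq split: if_splits)+
  have AB: "\<forall>a\<in>A. a < c" "\<forall>a\<in>A. a < c + 1" "\<forall>b\<in>B. c < b" "\<forall>b\<in>B. c + 1 < b"
    by (auto simp: A_def B_def)
  have eq: "bhat n G T ?u i = bhat n G S ?u i" if "i \<noteq> c" "i \<noteq> c + 1" for i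
    using at_u that by simp
  have "{i. bhat n G T ?u i = 1} = A \<union> {c} \<union> B"
  proof (rule set_eqI)
    fix i show "i \<in> {i. bhat n G T ?u i = 1} \<longleftrightarrow> i \<in> A \<union> {c} \<union> B"
      using Sc eq[of i] by (cases i "c" rule: linorder_cases; cases "i = c + 1") (auto simp: A_def B_def)
  qed
  then have seqT: "seq (bhat n G T ?u) = sorted_list_of_set A @ c # sorted_list_of_set B"
    unfolding seq_def by (simp only: sorted_list_of_set_split[OF fin AB(1,3)])
  have "{i. bhat n G S ?u i = 1} = A \<union> {c + 1} \<union> B"
  proof (rule set_eqI)
    fix i show "i \<in> {i. bhat n G S ?u i = 1} \<longleftrightarrow> i \<in> A \<union> {c + 1} \<union> B"
      using Sc by (cases i "c" rule: linorder_cases; cases "i = c + 1") (auto simp: A_def B_def)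
  qed
  then have seqS: "seq (bhat n G S ?u) = sorted_list_of_set A @ (c + 1) # sorted_list_of_set B"
    unfolding seq_def by (simp only: sorted_list_of_set_split[OF fin AB(2,4)])
  obtain ys zs where yz: "bverts_list G = ys @ ?u # zs"
    using u split_list[of ?u "bverts_list G"] bverts_list(1)[OF web] by auto
  have "Re v < Re ?u \<and> v \<in> boundary_verts G" if "v \<in> set ys" for v
    using bverts_list(1,2)[OF web] that unfolding yz by (auto simp: sorted_wrt_append)
  then have pre: "map (seq \<circ> bhat n G T) ys = map (seq \<circ> bhat n G S) ys" using same by simp
  have "mon_less (xmon n G T) (xmon n G S)"
    unfolding mon_less_def xmon_def yz
    by (simp add: pre seqS seqT lexord_same_pref_iff)
  with T show ?thesis by blast
qed

section \<open>Ballot property of the strand ends\<close>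

lemma strand_ends_sum:
  assumes web: "web n G" and str: "stranding n G S" and X: "finite X"
  shows "card (X \<inter> dart_src G ` \<Union>(S c)) = (\<Sum>C\<in>S c. card (X \<inter> dart_src G ` C))"
    and "card (X \<inter> dart_tgt G ` \<Union>(S c)) = (\<Sum>C\<in>S c. card (X \<inter> dart_tgt G ` C))"
proof -
  have "C \<subseteq> darts G" if "C \<in> S c" for C
    using that str arc_or_loop_balanced unfolding stranding_def balanced_def by blast
  then have "S c \<subseteq> Pow (darts G)" by blast
  then have fin: "finite (S c)" using web_finite_darts[OF web] finite_subset by blast
  have disj: "curve_verts G C \<inter> curve_verts G C' = {}" if "C \<in> S c" "C' \<in> S c" "C \<noteq> C'" for C C'
    using str that unfolding stranding_def pairwise_def by blast
  have "card (\<Union>C\<in>S c. X \<inter> dart_src G ` C) = (\<Sum>C\<in>S c. card (X \<inter> dart_src G ` C))"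
    using fin X disj unfolding curve_verts_def by (intro card_UN_disjoint) blast+
  then show "card (X \<inter> dart_src G ` \<Union>(S c)) = (\<Sum>C\<in>S c. card (X \<inter> dart_src G ` C))"
    by (simp only: image_Union Int_UN_distrib)
  have "card (\<Union>C\<in>S c. X \<inter> dart_tgt G ` C) = (\<Sum>C\<in>S c. card (X \<inter> dart_tgt G ` C))"
    using fin X disj unfolding curve_verts_def by (intro card_UN_disjoint) blast+
  then show "card (X \<inter> dart_tgt G ` \<Union>(S c)) = (\<Sum>C\<in>S c. card (X \<inter> dart_tgt G ` C))"
    by (simp only: image_Union Int_UN_distrib)
qed

text \<open>Applied to the leftmost boundary vertices, for which \<open>arcs\<close> follows if all
  arcs are clockwise. A loop contributes equally to both sides.\<close>

lemma strand_ends_le: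
  assumes web: "web n G" and str: "stranding n G S" and X: "finite X" "X \<subseteq> boundary_verts G"
    and arcs: "\<And>ds. set ds \<in> S c \<Longrightarrow> arc_walk G ds \<Longrightarrow> dart_src G (hd ds) \<in> X \<Longrightarrow>
      dart_tgt G (last ds) \<in> X"
  shows "card (X \<inter> dart_src G ` \<Union>(S c)) \<le> card (X \<inter> dart_tgt G ` \<Union>(S c))"
  unfolding strand_ends_sum[OF web str X(1)]
proof (rule sum_mono)
  fix C assume C: "C \<in> S c"
  then consider ds where "arc_walk G ds" "C = set ds" | ds where "loop_walk G ds" "C = set ds"
    using str unfolding stranding_def is_arc_def is_loop_def by blast
  then show "card (X \<inter> dart_src G ` C) \<le> card (X \<inter> dart_tgt G ` C)"
  proof cases
    case 1
    have "X \<inter> dart_src G ` C = X \<inter> {dart_src G (hd ds)}" "X \<inter> dart_tgt G ` C = X \<inter> {dart_tgt G (last ds)}"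
      using arc_walk_ends[OF web 1(1)] X(2) unfolding 1(2) by blast+
    then show ?thesis
      using arcs[of ds] C 1 by (cases "dart_src G (hd ds) \<in> X") simp_all
  next
    case 2
    then show ?thesis using loop_walk_balanced(2)[OF 2(1)] by simp
  qed
qed

lemma strand_ends_total:
  assumes web: "web n G" and str: "stranding n G S"
  shows "card (boundary_verts G \<inter> dart_src G ` \<Union>(S c)) = card (boundary_verts G \<inter> dart_tgt G ` \<Union>(S c))"
proof -
  have fin: "finite (boundary_verts G)"
    using web by (simp add: web_def halfplane_graph_def boundary_verts_def)
  show ?thesis
    unfolding strand_ends_sum[OF web str fin]
  proof (rule sum.cong[OF refl])
    fix C assume C: "C \<in> S c"
    then consider ds where "arc_walk G ds" "C = set ds" | ds where "loop_walk G ds" "C = set ds"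
      using str unfolding stranding_def is_arc_def is_loop_def by blast
    then show "card (boundary_verts G \<inter> dart_src G ` C) = card (boundary_verts G \<inter> dart_tgt G ` C)"
    proof cases
      case 1
      have "boundary_verts G \<inter> dart_src G ` C = {dart_src G (hd ds)}"
        "boundary_verts G \<inter> dart_tgt G ` C = {dart_tgt G (last ds)}"
        using arc_walk_ends[OF web 1(1)] 1 unfolding arc_walk_def by blast+
      then show ?thesis by simp
    next
      case 2
      then show ?thesis using loop_walk_balanced(2)[OF 2(1)] by simp
    qed
  qed
qed

lemma sum_bd_flow:
  assumes "finite X"
  shows "(\<Sum>v\<in>X. bd_flow G D v) = int (card (X \<inter> dart_tgt G ` D)) - int (card (X \<inter> dart_src G ` D))"
  using assms by (simp add: bd_flow_def sum_subtractf of_bool_def sum.If_cases Int_def)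

text \<open>If the entry of \<open>B\<close> at \<open>p\<close> were smaller than that of
  \<open>A\<close>, then up to this entry \<open>B\<close> would have at least \<open>p + 1\<close>
  elements and \<open>A\<close> at most \<open>p\<close>.\<close>

lemma sorted_list_of_set_nth_le:
  fixes A B :: "nat set"
  assumes fin: "finite A" "finite B" and p: "p < card A" "p < card B"
    and le: "\<And>t. card (B \<inter> {..t}) \<le> card (A \<inter> {..t})"
  shows "sorted_list_of_set A ! p \<le> sorted_list_of_set B ! p"
proof (rule ccontr)
  let ?a = "sorted_list_of_set A" and ?b = "sorted_list_of_set B"
  assume "\<not> ?a ! p \<le> ?b ! p"
  then have less: "?b ! p < ?a ! p" by simp
  let ?t = "?b ! p"
  have sa: "sorted_wrt (<) ?a" "sorted_wrt (<) ?b" by simp_all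
  have len: "length ?a = card A" "length ?b = card B" using fin by simp_all
  have "A \<inter> {..?t} \<subseteq> (!) ?a ` {..<p}"
  proof
    fix x assume x: "x \<in> A \<inter> {..?t}"
    then obtain i where i: "i < card A" "?a ! i = x"
      using fin len by (metis IntD1 in_set_conv_nth set_sorted_list_of_set)
    have "\<not> p \<le> i"
    proof
      assume "p \<le> i"
      then have "?a ! p \<le> ?a ! i"
        using sa(1) i len by (metis le_eq_less_or_eq sorted_wrt_nth_less)
      then show False using less x i by auto
    qed
    then show "x \<in> (!) ?a ` {..<p}" using i by auto
  qed
  then have "card (A \<inter> {..?t}) \<le> p"
    by (metis card_image_le card_lessThan card_mono finite_imageI finite_lessThan le_trans)
  moreover have "(!) ?b ` {..p} \<subseteq> B \<inter> {..?t}"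
  proof
    fix x assume "x \<in> (!) ?b ` {..p}"
    then obtain i where i: "i \<le> p" "x = ?b ! i" by auto
    have "?b ! i \<le> ?b ! p"
      using i sa(2) p len by (metis le_eq_less_or_eq sorted_wrt_nth_less)
    moreover have "?b ! i \<in> set ?b" using i p len by (metis le_less_trans nth_mem)
    ultimately show "x \<in> B \<inter> {..?t}" using i fin by simp
  qed
  then have "card ((!) ?b ` {..p}) \<le> card (B \<inter> {..?t})" using fin by (intro card_mono) auto
  moreover have "card ((!) ?b ` {..p}) = Suc p"
  proof -
    have "inj_on ((!) ?b) {..p}" using p len by (intro inj_on_nth) auto
    then show ?thesis by (simp add: card_image)
  qed
  ultimately show False using le[of ?t] by simp
qed

lemma count_list_concat: "count_list (concat xss) x = (\<Sum>xs\<leftarrow>xss. count_list xs x)"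
  by (induction xss) simp_all

lemma count_list_distinct: "distinct xs \<Longrightarrow> count_list xs x = of_bool (x \<in> set xs)"
  by (induction xs) auto

section \<open>The tableau of a leading term stranding\<close>

theorem theorem33:
  fixes n :: nat and k :: "nat list" and G :: "'e wgraph" and S :: "'e stranding"
  assumes "n \<ge> 2"
    and "\<forall>l\<in>set k. 1 \<le> l \<and> l \<le> n - 1"
    and "G \<in> webs n k"
    and "leading_term_stranding n G S"
  shows "tableau n G S \<in> RST n k"
proof -
  have web: "web n G" and k: "k = boundary_weights n G" using assms(3) by (auto simp: webs_def)
  have S: "S \<in> Str n G" using assms(4) by (simp add: leading_term_stranding_def)
  have str: "stranding n G S" using S by (simp add: Str_def valid_stranding_def)
  have n: "n \<ge> 1" using assms(1) by simp
  define xs where "xs = bverts_list G"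
  define m where "m = length xs"
  define \<beta> where "\<beta> c j = bhat n G S (xs ! j) c" for c j
  define N where "N c t = (\<Sum>j<t. \<beta> c j)" for c t
  \<comment> \<open>Factors are indexed from 0, tableau entries from 1; the bound on
    \<open>j\<close> from below excludes 0, for which \<open>j - 1\<close> would again be 0.\<close>
  define R where "R c = {j. 1 \<le> j \<and> j \<le> m \<and> \<beta> c (j - 1) = 1}" for c
  note xs = bverts_list[OF web, folded xs_def]
  have xs_b: "xs ! j \<in> boundary_verts G" if "j < m" for j
    using that xs(1) nth_mem unfolding m_def by metis
  have \<beta>01: "\<beta> c j \<in> {0, 1}" if "j < m" for c j
    unfolding \<beta>_def by (rule bhat_props(1)[OF web n S xs_b[OF that]])
  have finR: "finite (R c)" for c by (rule finite_subset[of _ "{..m}"]) (auto simp: R_def)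

  have N_diff: "N c t - N (c + 1) t = (\<Sum>v\<in>set (take t xs). bd_flow G (\<Union>(S c)) v)"
    if c: "c \<in> {1..<n}" and t: "t \<le> m" for c t
  proof -
    have "N c t - N (c + 1) t = (\<Sum>j<t. bd_flow G (\<Union>(S c)) (xs ! j))"
      unfolding N_def sum_subtractf[symmetric] \<beta>_def
      using t by (intro sum.cong refl bhat_props(3)[OF web n S xs_b c]) auto
    also have "\<dots> = (\<Sum>v\<in>(!) xs ` {..<t}. bd_flow G (\<Union>(S c)) v)"
      using xs(3) t by (subst sum.reindex) (auto intro!: inj_on_nth simp: m_def)
    also have "(!) xs ` {..<t} = set (take t xs)"
      using t by (simp add: m_def nth_image lessThan_atLeast0)
    finally show ?thesis .
  qed
  have N_le: "N (c + 1) t \<le> N c t" if c: "c \<in> {1..<n}" and t: "t \<le> m" for c t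
  proof -
    have "card (set (take t xs) \<inter> dart_src G ` \<Union>(S c)) \<le> card (set (take t xs) \<inter> dart_tgt G ` \<Union>(S c))"
    proof (rule strand_ends_le[OF web str])
      show "set (take t xs) \<subseteq> boundary_verts G" using xs(1) set_take_subset by metis
      fix ds assume ds: "set ds \<in> S c" "arc_walk G ds" "dart_src G (hd ds) \<in> set (take t xs)"
      let ?u = "dart_src G (hd ds)" and ?w = "dart_tgt G (last ds)"
      have uw: "?u \<in> boundary_verts G" "?w \<in> boundary_verts G" using ds(2) by (auto simp: arc_walk_def)
      \<comment> \<open>Here minimality of the leading term enters: no arc of colour
        \<open>c\<close> runs to the right.\<close>
      have "\<not> Re ?u < Re ?w"
        using ccw_arc_not_minimal[OF web n S ds(1) c ds(2)] leading_term_minimal[OF assms(4)] by blast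
      moreover have "xs = take t xs @ drop t xs" by simp
      then have "Re ?u < Re v" if "v \<in> set (drop t xs)" for v
        using xs(2) ds(3) that by (metis sorted_wrt_append)
      moreover have "?w \<in> set (take t xs) \<union> set (drop t xs)"
        using uw(2) xs(1) by (metis append_take_drop_id set_append)
      ultimately show "?w \<in> set (take t xs)" by blast
    qed simp
    then show ?thesis using N_diff[OF c t] sum_bd_flow[of "set (take t xs)" G "\<Union>(S c)"] by simp
  qed
  have N_total: "N (c + 1) m = N c m" if c: "c \<in> {1..<n}" for c
  proof -
    have "set (take m xs) = boundary_verts G" "finite (boundary_verts G)"
      using xs(1) by (auto simp: m_def simp flip: xs(1))
    then show ?thesis
      using N_diff[OF c order_refl] strand_ends_total[OF web str, of c]
        sum_bd_flow[of "set (take m xs)" G "\<Union>(S c)"] by simp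
  qed

  \<comment> \<open>The comparison of sorted rows asks for all thresholds \<open>t\<close>, also
    those beyond the last factor, hence \<open>min t m\<close>.\<close>
  have card_R: "int (card (R c \<inter> {..t})) = N c (min t m)" for c t
  proof -
    have "R c \<inter> {..t} = Suc ` {j. j < min t m \<and> \<beta> c j = 1}"
    proof (intro equalityI subsetI)
      fix j assume "j \<in> R c \<inter> {..t}"
      then have "j = Suc (j - 1)" "j - 1 \<in> {j. j < min t m \<and> \<beta> c j = 1}" by (auto simp: R_def)
      then show "j \<in> Suc ` {j. j < min t m \<and> \<beta> c j = 1}" by (rule image_eqI)
    qed (auto simp: R_def)
    then have "card (R c \<inter> {..t}) = card {j. j < min t m \<and> \<beta> c j = 1}"
      by (simp only: card_image[OF inj_Suc[THEN inj_on_subset[OF _ subset_UNIV]]])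
    also have "{j. j < min t m \<and> \<beta> c j = 1} = {..<min t m} \<inter> {j. \<beta> c j = 1}" by blast
    also have "int (card \<dots>) = (\<Sum>j<min t m. if \<beta> c j = 1 then 1 else 0)"
      by (simp add: sum.If_cases)
    also have "\<dots> = N c (min t m)"
      unfolding N_def using \<beta>01[of _ c] by (intro sum.cong refl) force
    finally show ?thesis .
  qed
  have R_m: "R c \<inter> {..m} = R c" for c by (auto simp: R_def)
  have card_R_le: "card (R (c + 1) \<inter> {..t}) \<le> card (R c \<inter> {..t})" if "c \<in> {1..<n}" for c t
    using N_le[OF that, of "min t m"] card_R[of c t] card_R[of "c + 1" t] by simp
  define r where "r = card (R 1)"
  have card_R_eq: "card (R c) = r" if "1 \<le> c" "c \<le> n" for c
    using that
  proof (induction rule: dec_induct)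
    case base
    show ?case by (simp add: r_def)
  next
    case (step c)
    then have "N (c + 1) m = N c m" by (intro N_total) auto
    then have "card (R (c + 1)) = card (R c)"
      using card_R[of c m] card_R[of "c + 1" m] R_m by simp
    then show ?case using step by simp
  qed

  have len_k: "length k = m" by (simp add: k boundary_weights_def m_def xs_def)
  have k_nth: "int (k ! j) = (\<Sum>c\<in>{1..n}. \<beta> c j)" if "j < m" for j
    using that bhat_props(2)[OF web n S xs_b[OF that]]
    by (simp add: \<beta>_def k boundary_weights_def Let_def m_def xs_def)
  \<comment> \<open>Double counting of the ones, by tensor factor and by row; this yields the
    divisibility by \<open>n\<close> and the row length \<open>r\<close>.\<close>
  have "int (sum_list k) = (\<Sum>j<m. int (k ! j))"
    by (simp add: sum_list_sum_nth len_k lessThan_atLeast0)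
  also have "\<dots> = (\<Sum>j<m. \<Sum>c\<in>{1..n}. \<beta> c j)" using k_nth by (intro sum.cong refl) simp
  also have "\<dots> = (\<Sum>c\<in>{1..n}. N c m)" unfolding N_def by (rule sum.swap)
  also have "\<dots> = (\<Sum>c\<in>{1..n}. int r)"
  proof (rule sum.cong[OF refl])
    fix c assume "c \<in> {1..n}"
    then show "N c m = int r" using card_R[of c m] R_m card_R_eq[of c] by simp
  qed
  finally have "int (sum_list k) = int (n * r)" by simp
  then have sum_k: "sum_list k = n * r" by (simp only: of_nat_eq_iff)
  then have row: "sum_list k div n = r" using n by simp

  let ?T = "tableau n G S"
  have T: "?T = map (\<lambda>c. sorted_list_of_set (R c)) [1..<n + 1]"
  proof -
    have "{j. 1 \<le> j \<and> j \<le> length (xmon n G S) \<and> (xmon n G S ! (j - 1)) c = 1} = R c" for c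
      by (auto simp: xmon_def R_def \<beta>_def m_def xs_def)
    then show ?thesis by (simp only: tableau_def Let_def)
  qed
  have T_nth: "?T ! i = sorted_list_of_set (R (i + 1))" if "i < n" for i
    using that by (simp add: T del: upt_Suc)
  have count: "count_list (concat ?T) j = (if 1 \<le> j \<and> j \<le> length k then k ! (j - 1) else 0)" for j
  proof -
    have "count_list (concat ?T) j = (\<Sum>c\<leftarrow>[1..<n + 1]. of_bool (j \<in> R c))"
      using finR by (simp add: T count_list_concat count_list_distinct o_def del: upt_Suc)
    also have "\<dots> = (\<Sum>c\<in>{1..n}. of_bool (j \<in> R c))"
      by (simp add: sum_list_distinct_conv_sum_set atLeastLessThanSuc_atLeastAtMost del: upt_Suc)
    finally have cnt: "count_list (concat ?T) j = (\<Sum>c\<in>{1..n}. of_bool (j \<in> R c))" .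
    show ?thesis
    proof (cases "1 \<le> j \<and> j \<le> m")
      case True
      then have "j - 1 < m" by auto
      note k_nth[OF this]
      moreover have "int (\<Sum>c\<in>{1..n}. of_bool (j \<in> R c)) = (\<Sum>c\<in>{1..n}. \<beta> c (j - 1))"
        using True \<beta>01[of "j - 1"] unfolding of_nat_sum by (intro sum.cong refl) (force simp: R_def)
      ultimately show ?thesis using cnt True len_k by simp
    next
      case False
      then have "j \<notin> R c" for c by (auto simp: R_def)
      then show ?thesis using cnt False len_k by auto
    qed
  qed
  have cols: "?T ! i ! p \<le> ?T ! Suc i ! p" if "Suc i < n" "p < r" for i p
  proof -
    have c: "i + 1 \<in> {1..<n}" using that by simp
    have "card (R (i + 1)) = r" "card (R (i + 2)) = r" using that by (auto intro: card_R_eq)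
    then have "sorted_list_of_set (R (i + 1)) ! p \<le> sorted_list_of_set (R (i + 2)) ! p"
      using that card_R_le[OF c] by (intro sorted_list_of_set_nth_le finR) (auto simp: add.assoc)
    then show ?thesis using that by (simp add: T_nth)
  qed
  have "length row' = r \<and> sorted_wrt (<) row'" if "row' \<in> set ?T" for row'
    using that card_R_eq finR by (auto simp: T)
  moreover have "length ?T = n" by (simp add: T)
  ultimately show ?thesis
    unfolding RST_def row using sum_k count cols by auto
qed

end
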